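(* Let $a,b\in\mathbb{R}$ be constants and let $M^n\subset\mathbb{R}^{n+1}$ be a rotated translational hypersurface parametrized by $$X(u,v)=Y(u)+Z_1(v)N^Y(u)+\sum_{r=2}^{t+1}Z_r(v)e_{s+r},\qquad s+t=n,$$ on an open subset where $H_n\neq 0$, whose directrix and profile hypersurfaces are parametrized by $Y(u)=(Y_1(u),\dots,Y_{s+1}(u))$, $u\in U\subset\mathbb{R}^s$, and $Z(v)=(Z_1(v),\dots,Z_{t+1}(v))$, $v\in V\subset\mathbb{R}^t$, respectively. Assume $a\neq -s$. Then $$N_1^XA_X=aX_1+b$$ if and only if there exists a constant $C\in\mathbb{R}$ such that $$N_1^{\widetilde Y}A_{\widetilde Y}=a\widetilde Y_1+b,\quad\text{where } \widetilde Y=Y-\frac{C}{s+a}N^Y,$$ $$N_1^ZA_Z=(a+s)Z_1+C.$$ Here $N^X$, $N^Y$, $N^Z$ denote the Gauss maps of $X,Y,Z$, and $X_1=\langle X,e_1\rangle$, $Y_1=\langle Y,e_1\rangle$, $Z_1=\langle Z,e_1\rangle$.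
   Context: For a hypersurface $W$ of dimension $m$ with Gauss map $N^W$ and nonzero principal curvatures $\kappa_1,\dots,\kappa_m$ (convention $N_{,i}=-\kappa_iW_{,i}$ in a parametrization by lines of curvature), $A_W=\sum_{i=1}^m 1/\kappa_i$ is the sum of the principal radial curvatures (equivalently $A_W=mH_{m-1}/H_m$, where $H_r=\binom{m}{r}^{-1}\sum_{i_1<\dots<i_r}\kappa_{i_1}\cdots\kappa_{i_r}$), $W_1=\langle W,e_1\rangle$ is the height function and $N_1^W=\langle N^W,e_1\rangle$ the angle function. For a curve ($m=1$) $A_W=1/\kappa$. Rotated translational hypersurface (normalized up to a rigid motion): $\{e_1,\dots,e_{n+1}\}$ is the canonical basis of $\mathbb{R}^{n+1}$, $1\le s\le n-1$, the directrix $Y$ is an immersed hypersurface of $\mathbb{R}^{s+1}=\mathrm{span}\{e_1,\dots,e_{s+1}\}$ with Gauss map $N^Y$, and the profile $Z$ is an immersed hypersurface of $\mathrm{span}\{e_1,e_{s+2},\dots,e_{s+t+1}\}\cong\mathbb{R}^{t+1}$; then $X$ is given by the formula in the claim and is defined at the points of $U\times V$ where $1-Z_1\kappa_i^Y\neq 0$ for all $1\le i\le s$, $\kappa_i^Y$ being the principal curvatures of $Y$. The parallel hypersurface $\widetilde Y=Y+\tau N^Y$ has Gauss map $N^{\widetilde Y}=N^Y$ and is considered on the open set where $1-\tau\kappa_i^Y\neq 0$ for all $i$.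
   Formalization: The converse gives the X equation only at points whose u lies in the closure of the set where the parallel hypersurface is regular (it fails otherwise, e.g. for Y a circle of radius τ), and the open domain of X is assumed connected or equal to U×V so that a single C exists. *)

theory Defs
  imports "HOL-Analysis.Analysis"
begin

text \<open>
  Conventions.  The parameter space of an \<open>m\<close>-dimensional hypersurface is a Euclidean space
  \<open>'m\<close> with \<open>DIM('m) = m\<close> (necessarily \<open>m \<ge> 1\<close>), and its ambient space of dimension
  \<open>m + 1\<close> is \<open>real \<times> 'm\<close>, the first factor being the line spanned by \<open>e\<^sub>1\<close>.
\<close>

primrec C_k_on :: "nat \<Rightarrow> ('m::euclidean_space \<Rightarrow> 'e::real_normed_vector) \<Rightarrow> 'm set \<Rightarrow> bool" where
  "C_k_on 0 f S \<longleftrightarrow> continuous_on S f"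
| "C_k_on (Suc k) f S \<longleftrightarrow>
     f differentiable_on S \<and> (\<forall>h. C_k_on k (\<lambda>x. frechet_derivative f (at x) h) S)"

definition immersed_hypersurface_on ::
    "'m set \<Rightarrow> ('m::euclidean_space \<Rightarrow> real \<times> 'm) \<Rightarrow> bool" where
  "immersed_hypersurface_on S W \<longleftrightarrow>
     open S \<and> C_k_on 2 W S \<and> (\<forall>u\<in>S. inj (frechet_derivative W (at u)))"

text \<open>A Gauss map is unique up to a sign on each connected component of the domain.\<close>

definition gauss_map_on ::
    "'m set \<Rightarrow> ('m::euclidean_space \<Rightarrow> real \<times> 'm) \<Rightarrow> ('m \<Rightarrow> real \<times> 'm) \<Rightarrow> bool" where
  "gauss_map_on S W N \<longleftrightarrow>
     C_k_on 1 N S \<and>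
     (\<forall>u\<in>S. norm (N u) = 1 \<and> (\<forall>h. N u \<bullet> frechet_derivative W (at u) h = 0))"

text \<open>Tangent directions (in the parameter space) satisfying \<open>dN h = - \<kappa> dW h\<close>.\<close>

definition principal_space ::
    "('m::euclidean_space \<Rightarrow> real \<times> 'm) \<Rightarrow> ('m \<Rightarrow> real \<times> 'm) \<Rightarrow> 'm \<Rightarrow> real \<Rightarrow> 'm set" where
  "principal_space W N u \<kappa> =
     {h. frechet_derivative N (at u) h = - \<kappa> *\<^sub>R frechet_derivative W (at u) h}"

definition principal_curvatures ::
    "('m::euclidean_space \<Rightarrow> real \<times> 'm) \<Rightarrow> ('m \<Rightarrow> real \<times> 'm) \<Rightarrow> 'm \<Rightarrow> real set" where
  "principal_curvatures W N u = {\<kappa>. \<exists>h. h \<noteq> 0 \<and> h \<in> principal_space W N u \<kappa>}"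

text \<open>
  In a list \<open>\<kappa>\<^sub>1, \<dots>, \<kappa>\<^sub>m\<close> of the principal curvatures each value occurs as often as the
  dimension of its principal space.  So the product \<open>H\<^sub>m = \<kappa>\<^sub>1 \<cdots> \<kappa>\<^sub>m\<close> and the sum
  \<open>A\<^sub>W = 1/\<kappa>\<^sub>1 + \<dots> + 1/\<kappa>\<^sub>m\<close> are taken over the distinct values, with these
  multiplicities.
\<close>

definition gauss_kronecker ::
    "('m::euclidean_space \<Rightarrow> real \<times> 'm) \<Rightarrow> ('m \<Rightarrow> real \<times> 'm) \<Rightarrow> 'm \<Rightarrow> real" where
  "gauss_kronecker W N u =
     (\<Prod>\<kappa>\<in>principal_curvatures W N u. \<kappa> ^ dim (principal_space W N u \<kappa>))"

definition radial_curvature_sum ::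
    "('m::euclidean_space \<Rightarrow> real \<times> 'm) \<Rightarrow> ('m \<Rightarrow> real \<times> 'm) \<Rightarrow> 'm \<Rightarrow> real" where
  "radial_curvature_sum W N u =
     (\<Sum>\<kappa>\<in>principal_curvatures W N u. real (dim (principal_space W N u \<kappa>)) * (1 / \<kappa>))"

definition e1 :: "real \<times> 'm::euclidean_space" where
  "e1 = (1, 0)"

definition radial_equation ::
    "real \<Rightarrow> real \<Rightarrow> ('m::euclidean_space \<Rightarrow> real \<times> 'm) \<Rightarrow> ('m \<Rightarrow> real \<times> 'm) \<Rightarrow> 'm \<Rightarrow> bool" where
  "radial_equation a b W N u \<longleftrightarrow>
     (N u \<bullet> e1) * radial_curvature_sum W N u = a * (W u \<bullet> e1) + b"

text \<open>
  With \<open>DIM('a) = s\<close> and \<open>DIM('b) = t\<close>, the ambient space of the rotated translational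
  hypersurface is \<open>real \<times> 'a \<times> 'b\<close>: the three factors are the spans of \<open>e\<^sub>1\<close>, of
  \<open>e\<^sub>2, \<dots>, e\<^bsub>s+1\<^esub>\<close> and of \<open>e\<^bsub>s+2\<^esub>, \<dots>, e\<^bsub>s+t+1\<^esub>\<close>.  The directrix space is
  embedded by \<open>directrix_incl\<close>; \<open>(0, 0, r)\<close> for \<open>r \<in> Basis\<close> runs through
  \<open>e\<^bsub>s+2\<^esub>, \<dots>, e\<^bsub>s+t+1\<^esub>\<close>, and \<open>Z v \<bullet> (0, r)\<close> is the corresponding coordinate
  of the profile.
\<close>

definition directrix_incl :: "real \<times> 'a::euclidean_space \<Rightarrow> real \<times> 'a \<times> 'b::euclidean_space" where
  "directrix_incl y = (fst y, snd y, 0)"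

definition rotated_translational ::
    "('a::euclidean_space \<Rightarrow> real \<times> 'a) \<Rightarrow> ('a \<Rightarrow> real \<times> 'a) \<Rightarrow>
     ('b::euclidean_space \<Rightarrow> real \<times> 'b) \<Rightarrow> 'a \<times> 'b \<Rightarrow> real \<times> 'a \<times> 'b" where
  "rotated_translational Y NY Z = (\<lambda>(u, v).
     directrix_incl (Y u) + (Z v \<bullet> e1) *\<^sub>R directrix_incl (NY u)
       + (\<Sum>r\<in>Basis. (Z v \<bullet> (0, r)) *\<^sub>R (0, 0, r)))"

definition parallel_hypersurface ::
    "real \<Rightarrow> ('m::euclidean_space \<Rightarrow> real \<times> 'm) \<Rightarrow> ('m \<Rightarrow> real \<times> 'm) \<Rightarrow> 'm \<Rightarrow> real \<times> 'm" where
  "parallel_hypersurface \<tau> Y NY = (\<lambda>u. Y u + \<tau> *\<^sub>R NY u)"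

text \<open>The points at which the parallel hypersurface at distance \<open>\<tau>\<close> is an immersion.\<close>

definition parallel_domain ::
    "real \<Rightarrow> ('m::euclidean_space \<Rightarrow> real \<times> 'm) \<Rightarrow> ('m \<Rightarrow> real \<times> 'm) \<Rightarrow> 'm set \<Rightarrow> 'm set" where
  "parallel_domain \<tau> Y NY S = {u\<in>S. \<forall>\<kappa>\<in>principal_curvatures Y NY u. 1 - \<tau> * \<kappa> \<noteq> 0}"

text \<open>
  The two equations, for the constant \<open>C\<close>, over the part \<open>S\<close> of the directrix and the part \<open>T\<close>
  of the profile.  The parallel hypersurface has the same Gauss map as the directrix.
\<close>

definition directrix_profile_equations ::
    "real \<Rightarrow> real \<Rightarrow> real \<Rightarrow>
     ('a::euclidean_space \<Rightarrow> real \<times> 'a) \<Rightarrow> ('a \<Rightarrow> real \<times> 'a) \<Rightarrow> 'a set \<Rightarrow>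
     ('b::euclidean_space \<Rightarrow> real \<times> 'b) \<Rightarrow> ('b \<Rightarrow> real \<times> 'b) \<Rightarrow> 'b set \<Rightarrow> bool" where
  "directrix_profile_equations a b C Y NY S Z NZ T \<longleftrightarrow>
     (let s = real DIM('a); \<tau> = - C / (s + a) in
       (\<forall>u\<in>parallel_domain \<tau> Y NY S.
          radial_equation a b (parallel_hypersurface \<tau> Y NY) NY u) \<and>
       (\<forall>v\<in>T. radial_equation (a + s) C Z NZ v))"

end

theory Submission
  imports Defs
begin

text \<open>
  Let \<open>\<kappa>\<^sub>i\<close> be the principal curvatures of the directrix, \<open>s\<close> in number, and \<open>\<mu>\<^sub>j\<close> those of the profile.  A unit
  normal of \<open>X\<close> at \<open>(u, v)\<close> is \<open>N\<^sup>Z\<^sub>1(v) N\<^sup>Y(u)\<close> together with the remaining coordinates of \<open>N\<^sup>Z(v)\<close>.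
  Directions along \<open>Y\<close> and along \<open>Z\<close> do not interact, so the principal curvatures of \<open>X\<close> are
  \<open>N\<^sup>Z\<^sub>1 \<kappa>\<^sub>i / (1 - Z\<^sub>1 \<kappa>\<^sub>i)\<close> and \<open>\<mu>\<^sub>j\<close>.  Adding the reciprocals and multiplying by
  \<open>N\<^sup>X\<^sub>1 = N\<^sup>Z\<^sub>1 N\<^sup>Y\<^sub>1\<close> gives
  \<open>N\<^sup>X\<^sub>1 A\<^sub>X = N\<^sup>Y\<^sub>1 (A\<^sub>Y - s Z\<^sub>1 + N\<^sup>Z\<^sub>1 A\<^sub>Z)\<close>, which is
  \<open>rotated_translational_angle_times_radial_sum\<close>.  Since \<open>X\<^sub>1 = Y\<^sub>1 + Z\<^sub>1 N\<^sup>Y\<^sub>1\<close>, the equation for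
  \<open>X\<close> separates into \<open>F(u) = N\<^sup>Y\<^sub>1(u) G(v)\<close> with \<open>F = N\<^sup>Y\<^sub>1 A\<^sub>Y - a Y\<^sub>1 - b\<close> and
  \<open>G = (a + s) Z\<^sub>1 - N\<^sup>Z\<^sub>1 A\<^sub>Z\<close>.  The profile equation says \<open>G = - C\<close>.  Because the radii of curvature of
  \<open>Y + \<tau> N\<^sup>Y\<close> are \<open>1/\<kappa>\<^sub>i - \<tau>\<close>, the directrix equation for \<open>\<tau> = - C/(s + a)\<close> says
  \<open>F = - C N\<^sup>Y\<^sub>1\<close> (\<open>parallel_radial_equation_iff\<close>).

  The converse implication is then immediate over the parallel domain, and it passes to the closure
  because \<open>A\<^sub>Y\<close> is continuous (\<open>radial_curvature_sum_continuous\<close>).  For the direct implication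
  \<open>G\<close> has to be constant.  The equation \<open>F = N\<^sup>Y\<^sub>1 G\<close> forces this over any \<open>u\<close> with
  \<open>N\<^sup>Y\<^sub>1(u) \<noteq> 0\<close>; such \<open>u\<close> are dense, since nonzero curvatures make \<open>N\<^sup>Y\<close> an immersion into the
  sphere (\<open>angle_nonzero_dense\<close>), so \<open>G\<close> is locally constant on \<open>\<Omega>\<close>.  If
  \<open>\<Omega>\<close> is connected this suffices; if \<open>\<Omega> = U \<times> V\<close>, a single such \<open>u\<close> serves for all \<open>v\<close>.

  The curvatures are defined as a set of values with multiplicities.  All computations run through a
  basis of principal directions, a \<open>principal_frame\<close>, in which each \<open>\<kappa>\<^sub>i\<close> has its own index.  Its
  existence is the spectral theorem for the shape operator, whose symmetry is that of the second
  derivatives of the parametrization.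
\<close>

section \<open>Symmetry of second derivatives\<close>

text \<open>
  The mean value theorem, first in the direction \<open>h\<close> and then in the direction \<open>k\<close>, turns the second
  difference into a mixed derivative.  The left side is symmetric in \<open>h\<close> and \<open>k\<close>.
\<close>

lemma second_difference_mean_value:
  fixes f :: "'m::real_normed_vector \<Rightarrow> real"
  assumes f: "\<And>y. y \<in> ball x d \<Longrightarrow> (f has_derivative f' y) (at y)"
    and fh: "\<And>y. y \<in> ball x d \<Longrightarrow> ((\<lambda>y. f' y h) has_derivative fh y) (at y)"
    and t: "0 < t" "t * (norm h + norm k) < d"
  shows "\<exists>p\<in>ball x d. f (x + t *\<^sub>R h + t *\<^sub>R k) - f (x + t *\<^sub>R h) - f (x + t *\<^sub>R k) + f x
           = t\<^sup>2 * fh p k"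
proof -
  have inb: "x + s *\<^sub>R h + r *\<^sub>R k \<in> ball x d" if "0 \<le> s" "s \<le> t" "0 \<le> r" "r \<le> t" for s r
  proof -
    have "norm (s *\<^sub>R h + r *\<^sub>R k) \<le> s * norm h + r * norm k"
      using that norm_triangle_ineq[of "s *\<^sub>R h" "r *\<^sub>R k"] by simp
    also have "\<dots> \<le> t * norm h + t * norm k"
      using that by (intro add_mono mult_right_mono) auto
    also have "\<dots> < d" using t by (simp add: distrib_left)
    finally have "norm (s *\<^sub>R h + r *\<^sub>R k) < d" .
    moreover have "dist x (x + s *\<^sub>R h + r *\<^sub>R k) = norm (s *\<^sub>R h + r *\<^sub>R k)"
      by (metis add.assoc dist_add_cancel dist_0_norm add.right_neutral)
    ultimately show ?thesis by simp
  qed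
  have f'lin: "f' y (c *\<^sub>R l) = c * f' y l" if "y \<in> ball x d" for y c l
    using f[OF that] by (simp add: has_derivative_bounded_linear linear_simps)
  have fhlin: "fh y (c *\<^sub>R l) = c * fh y l" if "y \<in> ball x d" for y c l
    using fh[OF that] by (simp add: has_derivative_bounded_linear linear_simps)
  define g where "g = (\<lambda>s. f (x + s *\<^sub>R h + t *\<^sub>R k) - f (x + s *\<^sub>R h))"
  have g': "(g has_real_derivative f' (x + s *\<^sub>R h + t *\<^sub>R k) h - f' (x + s *\<^sub>R h) h) (at s)"
    if "0 \<le> s" "s \<le> t" for s
  proof -
    have 1: "x + s *\<^sub>R h + t *\<^sub>R k \<in> ball x d" using inb[of s t] that t by simp
    have 2: "x + s *\<^sub>R h \<in> ball x d" using inb[of s 0] that t by simp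
    have "((\<lambda>s. f (x + s *\<^sub>R h + t *\<^sub>R k)) has_derivative (\<lambda>c. f' (x + s *\<^sub>R h + t *\<^sub>R k) (c *\<^sub>R h))) (at s)"
      by (rule has_derivative_compose[of "\<lambda>s. x + s *\<^sub>R h + t *\<^sub>R k" _ _ UNIV, OF _ f[OF 1]])
        (auto intro!: derivative_eq_intros)
    moreover have "((\<lambda>s. f (x + s *\<^sub>R h)) has_derivative (\<lambda>c. f' (x + s *\<^sub>R h) (c *\<^sub>R h))) (at s)"
      by (rule has_derivative_compose[of "\<lambda>s. x + s *\<^sub>R h" _ _ UNIV, OF _ f[OF 2]])
        (auto intro!: derivative_eq_intros)
    ultimately have "(g has_derivative (\<lambda>c. f' (x + s *\<^sub>R h + t *\<^sub>R k) (c *\<^sub>R h) - f' (x + s *\<^sub>R h) (c *\<^sub>R h))) (at s)"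
      unfolding g_def by (rule has_derivative_diff)
    then show ?thesis
      by (rule has_derivative_imp_has_field_derivative) (simp only: f'lin[OF 1] f'lin[OF 2] right_diff_distrib)
  qed
  obtain s where s: "0 < s" "s < t"
      "g t - g 0 = (t - 0) * (f' (x + s *\<^sub>R h + t *\<^sub>R k) h - f' (x + s *\<^sub>R h) h)"
    using MVT2[OF t(1), of g, OF g'] by blast
  define m where "m = (\<lambda>r. f' (x + s *\<^sub>R h + r *\<^sub>R k) h)"
  have m': "(m has_real_derivative fh (x + s *\<^sub>R h + r *\<^sub>R k) k) (at r)" if "0 \<le> r" "r \<le> t" for r
  proof -
    have 1: "x + s *\<^sub>R h + r *\<^sub>R k \<in> ball x d" using inb[of s r] that s by simp
    have "(m has_derivative (\<lambda>c. fh (x + s *\<^sub>R h + r *\<^sub>R k) (c *\<^sub>R k))) (at r)"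
      unfolding m_def
      by (rule has_derivative_compose[of "\<lambda>r. x + s *\<^sub>R h + r *\<^sub>R k" _ _ UNIV, OF _ fh[OF 1]])
        (auto intro!: derivative_eq_intros)
    then show ?thesis
      by (rule has_derivative_imp_has_field_derivative) (simp add: fhlin[OF 1])
  qed
  obtain r where r: "0 < r" "r < t" "m t - m 0 = (t - 0) * fh (x + s *\<^sub>R h + r *\<^sub>R k) k"
    using MVT2[OF t(1), of m, OF m'] by blast
  have "g t - g 0 = t * (t * fh (x + s *\<^sub>R h + r *\<^sub>R k) k)"
    using s(3) r(3) by (simp add: m_def)
  then have "f (x + t *\<^sub>R h + t *\<^sub>R k) - f (x + t *\<^sub>R h) - f (x + t *\<^sub>R k) + f x
      = t\<^sup>2 * fh (x + s *\<^sub>R h + r *\<^sub>R k) k"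
    by (simp add: g_def power2_eq_square)
  moreover have "x + s *\<^sub>R h + r *\<^sub>R k \<in> ball x d" using inb[of s r] s r by simp
  ultimately show ?thesis by blast
qed

lemma second_derivative_symmetric:
  fixes f :: "'m::real_normed_vector \<Rightarrow> real"
  assumes "open S" "x \<in> S"
    and f: "\<And>y. y \<in> S \<Longrightarrow> (f has_derivative f' y) (at y)"
    and fh: "\<And>y. y \<in> S \<Longrightarrow> ((\<lambda>y. f' y h) has_derivative fh y) (at y)"
    and fk: "\<And>y. y \<in> S \<Longrightarrow> ((\<lambda>y. f' y k) has_derivative fk y) (at y)"
    and ch: "continuous_on S (\<lambda>y. fh y k)" and ck: "continuous_on S (\<lambda>y. fk y h)"
  shows "fh x k = fk x h"
proof (rule ccontr)
  assume ne: "fh x k \<noteq> fk x h"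
  define e where "e = \<bar>fh x k - fk x h\<bar> / 2"
  have e: "e > 0" using ne by (simp add: e_def)
  have "isCont (\<lambda>y. fh y k) x" "isCont (\<lambda>y. fk y h) x"
    using assms continuous_on_eq_continuous_at by blast+
  then obtain d1 d2 where d1: "d1 > 0" "\<And>y. dist y x < d1 \<Longrightarrow> dist (fh y k) (fh x k) < e"
    and d2: "d2 > 0" "\<And>y. dist y x < d2 \<Longrightarrow> dist (fk y h) (fk x h) < e"
    using e unfolding continuous_at_eps_delta dist_norm by metis
  obtain d0 where d0: "d0 > 0" "ball x d0 \<subseteq> S" using assms(1,2) openE by blast
  define d where "d = min d0 (min d1 d2)"
  have d: "d > 0" "ball x d \<subseteq> S" using d0 d1 d2 by (auto simp: d_def)
  (* the summand 1 keeps the denominator positive when h = k = 0 *)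
  define t where "t = d / (2 * (1 + norm h + norm k))"
  have pos: "1 + norm h + norm k > 0" by (simp add: add_pos_nonneg)
  have t: "t > 0" using d pos by (simp add: t_def)
  have "t * (norm h + norm k) < t * (2 * (1 + norm h + norm k))"
    using t pos by (intro mult_strict_left_mono) auto
  also have "\<dots> = d" using pos by (simp add: t_def)
  finally have td: "t * (norm h + norm k) < d" .
  obtain p where p: "p \<in> ball x d" "f (x + t *\<^sub>R h + t *\<^sub>R k) - f (x + t *\<^sub>R h) - f (x + t *\<^sub>R k) + f x
           = t\<^sup>2 * fh p k"
    using second_difference_mean_value[of x d f f' h fh t k] f fh d t td by (metis subsetD)
  obtain q where q: "q \<in> ball x d" "f (x + t *\<^sub>R k + t *\<^sub>R h) - f (x + t *\<^sub>R k) - f (x + t *\<^sub>R h) + f x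
           = t\<^sup>2 * fk q h"
    using second_difference_mean_value[of x d f f' k fk t h] f fk d t td
    by (metis subsetD add.commute)
  have "t\<^sup>2 * fh p k = t\<^sup>2 * fk q h" using p(2) q(2) by (simp add: algebra_simps)
  then have "fh p k = fk q h" using t by simp
  moreover have "dist (fh p k) (fh x k) < e" "dist (fk q h) (fk x h) < e"
    using p(1) q(1) d1(2)[of p] d2(2)[of q] by (auto simp: d_def dist_commute)
  ultimately show False by (simp add: e_def dist_real_def abs_if split: if_splits)
qed

section \<open>Simultaneous diagonalization\<close>

text \<open>
  Both sides are subspaces of dimension \<open>DIM('m)\<close>.  For a tangent map and its normal this says that a
  vector orthogonal to the normal is tangent.
\<close>

lemma range_eq_orthogonal_complement:
  fixes L :: "'m::euclidean_space \<Rightarrow> real \<times> 'm"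
  assumes "linear L" "inj L" "n \<noteq> 0" "\<And>h. n \<bullet> L h = 0" "n \<bullet> x = 0"
  shows "x \<in> range L"
proof -
  have "range L = {x. n \<bullet> x = 0}"
  proof (rule subspace_dim_equal)
    show "subspace (range L)" using assms(1) by (simp add: linear_subspace_image)
    show "subspace {x. n \<bullet> x = 0}" by (rule subspace_hyperplane)
    show "range L \<subseteq> {x. n \<bullet> x = 0}" using assms(4) by auto
    have "dim (range L) = DIM('m)" using assms(1,2) by (simp add: dim_image_eq)
    then show "dim {x. n \<bullet> x = 0} \<le> dim (range L)" using assms(3) by (simp add: dim_hyperplane)
  qed
  then show ?thesis using assms(5) by blast
qed

text \<open>
  The spectral theorem for the operator \<open>P\<^sup>-\<^sup>1 Q\<close>, which is self-adjoint with respect to the inner product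
  \<open>P h \<bullet> P k\<close>.  Working with \<open>P\<close> and \<open>Q\<close> avoids passing to this inner product: eigenvectors are
  collected one at a time, the next one maximizing the Rayleigh quotient on the \<open>P\<close>-orthogonal
  complement \<open>S\<close> of those already found.
\<close>

lemma simultaneous_diagonalization:
  fixes P Q :: "'m::euclidean_space \<Rightarrow> 'e::euclidean_space"
  assumes P: "linear P" "inj P" and Q: "linear Q"
    and sym: "\<And>h k. P h \<bullet> Q k = P k \<bullet> Q h" and rng: "range Q \<subseteq> range P"
  shows "\<exists>(T :: 'm \<Rightarrow> 'm) \<mu>. linear T \<and> inj T \<and> (\<forall>b\<in>Basis. Q (T b) = - \<mu> b *\<^sub>R P (T b))"
proof -
  interpret P: linear P by fact
  interpret Q: linear Q by fact
  have P0: "P h = 0 \<longleftrightarrow> h = 0" for h using P(2) P.zero by (metis injD)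
  define eig where "eig = (\<lambda>E. finite E \<and> (\<forall>e\<in>E. e \<noteq> 0 \<and> (\<exists>\<kappa>. Q e = - \<kappa> *\<^sub>R P e)) \<and>
      pairwise (\<lambda>e e'. P e \<bullet> P e' = 0) E)"
  have "\<exists>E. eig E \<and> card E = n" if "n \<le> DIM('m)" for n
    using that
  proof (induction n)
    case 0
    then show ?case by (intro exI[of _ "{}"]) (simp add: eig_def)
  next
    case (Suc n)
    then obtain E where E: "eig E" "card E = n" by auto
    then have fin: "finite E" by (simp add: eig_def)
    define S where "S = {h. \<forall>e\<in>E. P h \<bullet> P e = 0}"
    define A where "A = (\<lambda>e. adjoint P (P e)) ` E"
    have S_adj: "S = {h. \<forall>x\<in>A. h \<bullet> x = 0}"
      by (simp add: S_def A_def adjoint_works[OF P(1)])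
    have "dim A \<le> n" unfolding A_def using fin E(2)
      by (metis card_image_le dim_le_card' finite_imageI le_trans)
    then obtain h1 where h1: "h1 \<noteq> 0" "\<And>y. y \<in> span A \<Longrightarrow> orthogonal h1 y"
      using orthogonal_to_subspace_exists[of A] Suc.prems by auto
    then have h1S: "h1 \<in> S" unfolding S_adj by (auto simp: orthogonal_def span_base)
    have scaleS: "c *\<^sub>R h \<in> S" if "h \<in> S" for c h using that by (simp add: S_def P.scale)
    have addS: "h + k \<in> S" if "h \<in> S" "k \<in> S" for h k
      using that by (simp add: S_def P.add inner_add_left)
    define K where "K = S \<inter> sphere 0 1"
    have "closed S" unfolding S_adj by (simp add: Collect_ball_eq closed_INT closed_hyperplane inner_commute)
    then have "compact K" unfolding K_def by (intro closed_Int_compact) auto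
    moreover have "(1 / norm h1) *\<^sub>R h1 \<in> K" using h1 h1S scaleS by (simp add: K_def)
    moreover define f where "f = (\<lambda>h. - (P h \<bullet> Q h) / (P h \<bullet> P h))"
    have "continuous_on K f" unfolding f_def
      using P(1) Q(1)
      by (intro continuous_intros linear_continuous_on linear_conv_bounded_linear[THEN iffD1])
        (auto simp: P0 K_def)
    ultimately obtain h0 where h0: "h0 \<in> K" "\<And>k. k \<in> K \<Longrightarrow> f k \<le> f h0"
      using continuous_attains_sup[of K f] by blast
    define \<kappa> where "\<kappa> = f h0"
    have h0S: "h0 \<in> S" "h0 \<noteq> 0" using h0 by (auto simp: K_def)
    (* with kappa the maximum of the quotient, P . Q + kappa (P . P) is a positive semidefinite form on S
       that vanishes at h0; h0 therefore lies in its kernel *)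
    have psd: "0 \<le> P k \<bullet> Q k + \<kappa> * (P k \<bullet> P k)" if "k \<in> S" for k
    proof (cases "k = 0")
      case True then show ?thesis by (simp add: P.zero)
    next
      case False
      have "(1 / norm k) *\<^sub>R k \<in> K" using that scaleS False by (simp add: K_def)
      from h0(2)[OF this] have "f k \<le> \<kappa>" using False by (simp add: f_def P.scale Q.scale \<kappa>_def)
      then show ?thesis using False P0[of k] by (simp add: f_def field_simps)
    qed
    have null: "P h0 \<bullet> Q h0 + \<kappa> * (P h0 \<bullet> P h0) = 0"
      using P0[of h0] h0S by (simp add: \<kappa>_def f_def)
    define r where "r = Q h0 + \<kappa> *\<^sub>R P h0"
    have rS: "r \<bullet> P k = 0" if k: "k \<in> S" for k
    proof -
      define \<beta> where "\<beta> = r \<bullet> P k"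
      define c where "c = P k \<bullet> Q k + \<kappa> * (P k \<bullet> P k)"
      have quad: "0 \<le> 2 * t * \<beta> + t\<^sup>2 * c" for t
      proof -
        have "h0 + t *\<^sub>R k \<in> S" using h0S k scaleS addS by blast
        from psd[OF this] have "0 \<le> (P h0 \<bullet> Q h0 + \<kappa> * (P h0 \<bullet> P h0)) + 2 * t * \<beta> + t\<^sup>2 * c"
          using sym[of h0 k]
          by (simp add: \<beta>_def c_def r_def P.add Q.add P.scale Q.scale inner_add_left inner_add_right
              inner_commute power2_eq_square algebra_simps)
        then show ?thesis using null by simp
      qed
      show "\<beta> = 0"
      proof (rule ccontr)
        assume "\<beta> \<noteq> 0"
        define D where "D = \<bar>c\<bar> + 1"
        have D: "D > 0" "c < D" by (auto simp: D_def)
        (* the step t = - beta / D is short enough for the linear term to dominate *)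
        have "2 * (- \<beta> / D) * \<beta> + (- \<beta> / D)\<^sup>2 * c = (\<beta>\<^sup>2 / D) * (c / D - 2)"
          using D by (simp add: field_simps power2_eq_square)
        moreover have "(\<beta>\<^sup>2 / D) * (c / D - 2) < 0"
        proof (rule mult_pos_neg)
          have "c / D < 1" using D by simp
          then show "c / D - 2 < 0" by simp
        qed (use D \<open>\<beta> \<noteq> 0\<close> in simp)
        ultimately have "2 * (- \<beta> / D) * \<beta> + (- \<beta> / D)\<^sup>2 * c < 0" by (simp only:)
        then show False using quad[of "- \<beta> / D"] by linarith
      qed
    qed
    have rE: "r \<bullet> P e = 0" if "e \<in> E" for e
    proof -
      obtain c where "Q e = - c *\<^sub>R P e" using E(1) \<open>e \<in> E\<close> by (auto simp: eig_def)
      moreover have "P h0 \<bullet> P e = 0" using h0S \<open>e \<in> E\<close> by (simp add: S_def)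
      moreover have "r \<bullet> P e = P h0 \<bullet> Q e + \<kappa> * (P h0 \<bullet> P e)"
        using sym[of h0 e] by (simp add: r_def inner_add_left inner_add_right inner_commute)
      ultimately show ?thesis by simp
    qed
    have rP: "r \<bullet> P k = 0" for k
    proof -
      define w where "w = (\<Sum>e\<in>E. ((P k \<bullet> P e) / (P e \<bullet> P e)) *\<^sub>R e)"
      have "k - w \<in> S"
        unfolding S_def
      proof safe
        fix e assume e: "e \<in> E"
        have "P w \<bullet> P e = (\<Sum>e'\<in>E. ((P k \<bullet> P e') / (P e' \<bullet> P e')) * (P e' \<bullet> P e))"
          by (simp add: w_def P.sum P.scale inner_sum_left)
        also have "\<dots> = (\<Sum>e'\<in>E. if e' = e then P k \<bullet> P e else 0)"
          using E(1) e P0 by (intro sum.cong) (auto simp: eig_def pairwise_def)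
        also have "\<dots> = P k \<bullet> P e" using fin e by simp
        finally show "P (k - w) \<bullet> P e = 0" by (simp add: P.diff inner_diff_left)
      qed
      then have "r \<bullet> P (k - w) = 0" by (rule rS)
      moreover have "r \<bullet> P w = 0" by (simp add: w_def P.sum P.scale inner_sum_right rE)
      ultimately show ?thesis by (simp add: P.diff inner_diff_right)
    qed
    obtain z where "Q h0 = P z" using rng by auto
    then have "r = P (z + \<kappa> *\<^sub>R h0)" by (simp add: r_def P.add P.scale)
    with rP[of "z + \<kappa> *\<^sub>R h0"] have "r = 0" by simp
    then have Qh0: "Q h0 = - \<kappa> *\<^sub>R P h0" by (simp add: r_def eq_neg_iff_add_eq_0)
    have h0E: "h0 \<notin> E" using h0S P0[of h0] by (auto simp: S_def)
    have "eig (insert h0 E)"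
      using E(1) Qh0 h0S unfolding eig_def pairwise_insert by (auto simp: S_def inner_commute)
    then show ?case using fin h0E E(2) by (intro exI[of _ "insert h0 E"]) simp
  qed
  then obtain E where E: "eig E" "card E = DIM('m)" by blast
  then have fin: "finite E" by (simp add: eig_def)
  obtain g where g: "bij_betw g (Basis :: 'm set) E"
    using finite_same_card_bij[of Basis E] fin E(2) by auto
  then have gE: "g b \<in> E" if "b \<in> Basis" for b using that bij_betwE by blast
  define T where "T = (\<lambda>h. \<Sum>b\<in>Basis. (h \<bullet> b) *\<^sub>R g b)"
  have T: "linear T" unfolding T_def
    by (intro linear_compose_sum linear_compose_scale ballI
        linear_conv_bounded_linear[THEN iffD2] bounded_linear_inner_left)
      (auto intro: bounded_linear_scaleR_const bounded_linear_inner_left)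
  have Tb: "T b = g b" if "b \<in> Basis" for b
    using that by (simp add: T_def inner_Basis if_distrib[of "\<lambda>c. c *\<^sub>R _"] cong: if_cong)
  have "h = 0" if "T h = 0" for h
  proof (rule euclidean_eqI)
    fix b :: 'm assume b: "b \<in> Basis"
    have "P (T h) \<bullet> P (g b) = (\<Sum>b'\<in>Basis. (h \<bullet> b') * (P (g b') \<bullet> P (g b)))"
      by (simp add: T_def P.sum P.scale inner_sum_left)
    also have "\<dots> = (\<Sum>b'\<in>Basis. if b' = b then (h \<bullet> b) * (P (g b) \<bullet> P (g b)) else 0)"
      using E(1) gE b g by (intro sum.cong) (auto simp: eig_def pairwise_def bij_betw_def inj_on_eq_iff)
    also have "\<dots> = (h \<bullet> b) * (P (g b) \<bullet> P (g b))" using b by simp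
    finally show "h \<bullet> b = 0 \<bullet> b"
      using that E(1) gE[OF b] P0[of "g b"] by (auto simp: P.zero eig_def)
  qed
  then have "inj T" using T linear_injective_0 by blast
  moreover have "\<forall>b\<in>Basis. \<exists>c. Q (T b) = - c *\<^sub>R P (T b)" using E(1) gE Tb by (simp add: eig_def)
  then obtain \<mu> where "\<forall>b\<in>Basis. Q (T b) = - \<mu> b *\<^sub>R P (T b)" by metis
  ultimately show ?thesis using T by blast
qed

section \<open>Symmetry of the shape operator\<close>

lemma immersed_hypersurface_has_derivative:
  assumes "immersed_hypersurface_on S W" "u \<in> S"
  shows "(W has_derivative frechet_derivative W (at u)) (at u)"
  using assms by (metis C_k_on.simps(2) differentiable_on_eq_differentiable_at frechet_derivative_works
      immersed_hypersurface_on_def numeral_2_eq_2)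

lemma gauss_map_has_derivative:
  assumes "gauss_map_on S W N" "open S" "u \<in> S"
  shows "(N has_derivative frechet_derivative N (at u)) (at u)"
  using assms by (metis C_k_on.simps(2) One_nat_def differentiable_on_eq_differentiable_at frechet_derivative_works
      gauss_map_on_def)

text \<open>
  Differentiate \<open>N \<bullet> N = 1\<close>.
\<close>

lemma gauss_map_derivative_tangent:
  assumes "gauss_map_on S W N" "open S" "u \<in> S"
  shows "N u \<bullet> frechet_derivative N (at u) h = 0"
proof -
  note N = gauss_map_has_derivative[OF assms]
  have "((\<lambda>y. N y \<bullet> N y) has_derivative (\<lambda>h. N u \<bullet> frechet_derivative N (at u) h + frechet_derivative N (at u) h \<bullet> N u)) (at u)"
    by (rule has_derivative_inner[OF N N])
  moreover have "((\<lambda>y. N y \<bullet> N y) has_derivative (\<lambda>h. 0)) (at u)"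
  proof (rule has_derivative_transform_within_open[OF has_derivative_const \<open>open S\<close> \<open>u \<in> S\<close>])
    show "1 = N y \<bullet> N y" if "y \<in> S" for y
      using assms(1) that by (simp add: gauss_map_on_def flip: power2_norm_eq_inner)
  qed
  ultimately have "N u \<bullet> frechet_derivative N (at u) h + frechet_derivative N (at u) h \<bullet> N u = 0"
    by (rule has_derivative_unique[THEN fun_cong])
  then show ?thesis by (simp add: inner_commute)
qed

text \<open>
  Differentiating \<open>N \<bullet> dW h = 0\<close> in the direction \<open>k\<close> gives
  \<open>dW h \<bullet> dN k = - N \<bullet> d\<^sup>2W(h, k)\<close>, and the second derivative is symmetric.
\<close>

lemma shape_operator_symmetric:
  assumes W: "immersed_hypersurface_on S W" and N: "gauss_map_on S W N" and u: "u \<in> S"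
  shows "frechet_derivative W (at u) h \<bullet> frechet_derivative N (at u) k =
         frechet_derivative W (at u) k \<bullet> frechet_derivative N (at u) h"
proof -
  define D where "D = (\<lambda>y. frechet_derivative W (at y))"
  define DD where "DD = (\<lambda>h y. frechet_derivative (\<lambda>y. D y h) (at y))"
  have S: "open S" using W by (simp add: immersed_hypersurface_on_def)
  have DD: "((\<lambda>y. D y h) has_derivative DD h y) (at y)" if "y \<in> S" for y h
    using W S that unfolding immersed_hypersurface_on_def D_def DD_def numeral_2_eq_2 C_k_on.simps
    by (metis differentiable_on_eq_differentiable_at frechet_derivative_works)
  have cDD: "continuous_on S (\<lambda>y. DD h y k)" for h k
    using W unfolding immersed_hypersurface_on_def D_def DD_def numeral_2_eq_2 C_k_on.simps by blast
  have Wd: "(W has_derivative D y) (at y)" if "y \<in> S" for y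
    unfolding D_def by (rule immersed_hypersurface_has_derivative[OF W that])
  have sym: "N u \<bullet> DD h u k = N u \<bullet> DD k u h"
  proof (rule second_derivative_symmetric[OF S u, of "\<lambda>y. N u \<bullet> W y" "\<lambda>y l. N u \<bullet> D y l"
        h "\<lambda>y l. N u \<bullet> DD h y l" k "\<lambda>y l. N u \<bullet> DD k y l"])
    show "((\<lambda>y. N u \<bullet> W y) has_derivative (\<lambda>l. N u \<bullet> D y l)) (at y)" if "y \<in> S" for y
      by (rule has_derivative_inner_right[OF Wd[OF that]])
    show "((\<lambda>y. N u \<bullet> D y l) has_derivative (\<lambda>k. N u \<bullet> DD l y k)) (at y)" if "y \<in> S" for y l
      by (rule has_derivative_inner_right[OF DD[OF that]])
    then show "((\<lambda>y. N u \<bullet> D y k) has_derivative (\<lambda>l. N u \<bullet> DD k y l)) (at y)" if "y \<in> S" for y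
      using that .
    show "continuous_on S (\<lambda>y. N u \<bullet> DD l y m)" for l m
      by (rule continuous_on_inner[OF continuous_on_const cDD])
    then show "continuous_on S (\<lambda>y. N u \<bullet> DD k y h)" .
  qed
  have "D u h \<bullet> frechet_derivative N (at u) k = - (N u \<bullet> DD h u k)" for h k
  proof -
    have "((\<lambda>y. N y \<bullet> D y h) has_derivative (\<lambda>k. N u \<bullet> DD h u k + frechet_derivative N (at u) k \<bullet> D u h)) (at u)"
      by (rule has_derivative_inner[OF gauss_map_has_derivative[OF N S u] DD[OF u]])
    moreover have "((\<lambda>y. N y \<bullet> D y h) has_derivative (\<lambda>k. 0)) (at u)"
    proof (rule has_derivative_transform_within_open[OF has_derivative_const S u])
      show "0 = N y \<bullet> D y h" if "y \<in> S" for y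
        using N that by (simp add: gauss_map_on_def D_def)
    qed
    ultimately have "N u \<bullet> DD h u k + frechet_derivative N (at u) k \<bullet> D u h = 0"
      by (rule has_derivative_unique[THEN fun_cong])
    then show ?thesis by (simp add: inner_commute)
  qed
  then show ?thesis using sym by (simp add: D_def)
qed

lemma tangent_maps:
  assumes "immersed_hypersurface_on S W" "gauss_map_on S W N" "u \<in> S"
  shows "linear (frechet_derivative W (at u))" "inj (frechet_derivative W (at u))"
    "linear (frechet_derivative N (at u))"
proof -
  have S: "open S" using assms by (simp add: immersed_hypersurface_on_def)
  show "linear (frechet_derivative W (at u))"
    using immersed_hypersurface_has_derivative[OF assms(1,3)] has_derivative_linear by blast
  show "inj (frechet_derivative W (at u))" using assms by (simp add: immersed_hypersurface_on_def)
  show "linear (frechet_derivative N (at u))"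
    using gauss_map_has_derivative[OF assms(2) S assms(3)] has_derivative_linear by blast
qed

section \<open>Principal frames\<close>

text \<open>
  A basis of principal directions \<open>T b\<close> with curvatures \<open>\<kappa> b\<close>, indexed by the standard basis of the
  parameter space, so that sums with multiplicities become sums over \<open>Basis\<close>.  The curvatures are read
  only on \<open>Basis\<close>.
\<close>

definition principal_frame ::
    "('m::euclidean_space \<Rightarrow> real \<times> 'm) \<Rightarrow> ('m \<Rightarrow> real \<times> 'm) \<Rightarrow> 'm \<Rightarrow> ('m \<Rightarrow> 'm) \<Rightarrow> ('m \<Rightarrow> real) \<Rightarrow> bool" where
  "principal_frame W N u T \<kappa> \<longleftrightarrow> linear T \<and> inj T \<and>
     (\<forall>b\<in>Basis. frechet_derivative N (at u) (T b) = - \<kappa> b *\<^sub>R frechet_derivative W (at u) (T b))"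

lemma principal_frame_exists:
  assumes W: "immersed_hypersurface_on S W" and N: "gauss_map_on S W N" and u: "u \<in> S"
  shows "\<exists>T \<kappa>. principal_frame W N u T \<kappa>"
  unfolding principal_frame_def
proof (rule simultaneous_diagonalization[of "frechet_derivative W (at u)" "frechet_derivative N (at u)"])
  have S: "open S" using W by (simp add: immersed_hypersurface_on_def)
  show lin: "linear (frechet_derivative W (at u))"
    using immersed_hypersurface_has_derivative[OF W u] has_derivative_linear by blast
  show inj: "inj (frechet_derivative W (at u))" using W u by (simp add: immersed_hypersurface_on_def)
  show "linear (frechet_derivative N (at u))"
    using gauss_map_has_derivative[OF N S u] has_derivative_linear by blast
  show "frechet_derivative W (at u) h \<bullet> frechet_derivative N (at u) k =
         frechet_derivative W (at u) k \<bullet> frechet_derivative N (at u) h" for h k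
    by (rule shape_operator_symmetric[OF W N u])
  show "range (frechet_derivative N (at u)) \<subseteq> range (frechet_derivative W (at u))"
  proof (rule image_subsetI)
    fix h
    have "N u \<noteq> 0" "\<And>h. N u \<bullet> frechet_derivative W (at u) h = 0"
      using N u by (auto simp: gauss_map_on_def)
    then show "frechet_derivative N (at u) h \<in> range (frechet_derivative W (at u))"
      by (intro range_eq_orthogonal_complement[OF lin inj _ _ gauss_map_derivative_tangent[OF N S u]])
  qed
qed

text \<open>
  In the coordinates of the frame \<open>dN + c dW\<close> is \<open>dW\<close> after the diagonal map with entries
  \<open>c - \<kappa> b\<close>, and \<open>dW\<close> is injective.
\<close>

lemma frame_principal_space:
  assumes F: "principal_frame W N u T \<kappa>"
    and W: "linear (frechet_derivative W (at u))" "inj (frechet_derivative W (at u))"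
    and N: "linear (frechet_derivative N (at u))"
  shows "principal_space W N u c = T ` span {b\<in>Basis. \<kappa> b = c}"
proof -
  have T: "linear T" "inj T" using F by (auto simp: principal_frame_def)
  interpret W: linear "frechet_derivative W (at u)" by fact
  interpret N: linear "frechet_derivative N (at u)" by fact
  have "T x \<in> principal_space W N u c \<longleftrightarrow> x \<in> span {b\<in>Basis. \<kappa> b = c}" for x
  proof -
    have Tx: "T x = (\<Sum>b\<in>Basis. (x \<bullet> b) *\<^sub>R T b)"
      using T(1) by (subst euclidean_representation[of x, symmetric]) (simp add: linear_sum linear_scale)
    define y where "y = (\<Sum>b\<in>Basis. ((c - \<kappa> b) * (x \<bullet> b)) *\<^sub>R b)"
    have Ty: "T y = (\<Sum>b\<in>Basis. ((c - \<kappa> b) * (x \<bullet> b)) *\<^sub>R T b)"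
      using T(1) by (simp add: y_def linear_sum linear_scale)
    have "frechet_derivative N (at u) (T x) + c *\<^sub>R frechet_derivative W (at u) (T x)
        = frechet_derivative W (at u) (T y)"
      unfolding Tx Ty W.sum N.sum W.scale N.scale scaleR_sum_right
      unfolding sum.distrib[symmetric]
      using F by (intro sum.cong refl) (simp add: principal_frame_def scaleR_diff_left algebra_simps)
    then have "T x \<in> principal_space W N u c \<longleftrightarrow> frechet_derivative W (at u) (T y) = 0"
      by (simp add: principal_space_def eq_neg_iff_add_eq_0)
    also have "\<dots> \<longleftrightarrow> y = 0"
      using W(2) T linear_0[OF T(1)] W.zero by (metis injD)
    also have "\<dots> \<longleftrightarrow> (\<forall>b\<in>Basis. \<kappa> b \<noteq> c \<longrightarrow> x \<bullet> b = 0)"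
      unfolding y_def euclidean_eq_iff[of _ 0]
      by (auto simp: inner_sum_left inner_Basis if_distrib[of "\<lambda>z. _ * z"] cong: if_cong)
    also have "\<dots> \<longleftrightarrow> x \<in> span {b\<in>Basis. \<kappa> b = c}"
      by (subst span_substd_basis) auto
    finally show ?thesis .
  qed
  then show ?thesis
    using surjD[OF linear_injective_imp_surjective[OF T]] by (intro set_eqI) (metis (no_types, lifting) image_eqI imageE)
qed

lemma frame_dim_principal_space:
  assumes F: "principal_frame W N u T \<kappa>"
    and W: "linear (frechet_derivative W (at u))" "inj (frechet_derivative W (at u))"
    and N: "linear (frechet_derivative N (at u))"
  shows "dim (principal_space W N u c) = card {b\<in>Basis. \<kappa> b = c}"
proof -
  have T: "linear T" "inj T" using F by (auto simp: principal_frame_def)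
  then have "dim (principal_space W N u c) = dim (span {b\<in>Basis. \<kappa> b = c})"
    unfolding frame_principal_space[OF assms]
    by (intro dim_image_eq[OF T(1)] inj_on_subset[OF T(2) subset_UNIV])
  also have "\<dots> = card {b\<in>Basis. \<kappa> b = c}"
    by (simp add: dim_eq_card_independent independent_mono[OF independent_Basis])
  finally show ?thesis .
qed

lemma frame_principal_curvatures:
  assumes F: "principal_frame W N u T \<kappa>"
    and W: "linear (frechet_derivative W (at u))" "inj (frechet_derivative W (at u))"
    and N: "linear (frechet_derivative N (at u))"
  shows "principal_curvatures W N u = \<kappa> ` Basis"
proof -
  have "c \<in> principal_curvatures W N u \<longleftrightarrow> {b\<in>Basis. \<kappa> b = c} \<noteq> {}" for c
  proof -
    have "c \<in> principal_curvatures W N u \<longleftrightarrow> (\<exists>h\<in>principal_space W N u c. h \<noteq> 0)"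
      unfolding principal_curvatures_def by blast
    also have "\<dots> \<longleftrightarrow> \<not> principal_space W N u c \<subseteq> {0}" by blast
    also have "\<dots> \<longleftrightarrow> dim (principal_space W N u c) \<noteq> 0" by simp
    also have "\<dots> \<longleftrightarrow> {b\<in>Basis. \<kappa> b = c} \<noteq> {}"
      unfolding frame_dim_principal_space[OF assms] by simp
    finally show ?thesis .
  qed
  then show ?thesis by (intro set_eqI) (auto simp: image_iff)
qed

lemma frame_radial_curvature_sum:
  assumes F: "principal_frame W N u T \<kappa>"
    and W: "linear (frechet_derivative W (at u))" "inj (frechet_derivative W (at u))"
    and N: "linear (frechet_derivative N (at u))"
  shows "radial_curvature_sum W N u = (\<Sum>b\<in>Basis. 1 / \<kappa> b)"
proof -
  have "(\<Sum>b\<in>Basis. 1 / \<kappa> b) = (\<Sum>c\<in>\<kappa> ` Basis. \<Sum>b\<in>{b\<in>Basis. \<kappa> b = c}. 1 / \<kappa> b)"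
    by (rule sum.image_gen) simp
  also have "\<dots> = (\<Sum>c\<in>\<kappa> ` Basis. real (card {b\<in>Basis. \<kappa> b = c}) * (1 / c))"
    by (intro sum.cong) auto
  finally show ?thesis
    unfolding radial_curvature_sum_def frame_principal_curvatures[OF assms]
      frame_dim_principal_space[OF assms] by simp
qed

lemma frame_gauss_kronecker_nonzero:
  assumes F: "principal_frame W N u T \<kappa>"
    and W: "linear (frechet_derivative W (at u))" "inj (frechet_derivative W (at u))"
    and N: "linear (frechet_derivative N (at u))"
    and H: "gauss_kronecker W N u \<noteq> 0" and b: "b \<in> Basis"
  shows "\<kappa> b \<noteq> 0"
proof
  assume 0: "\<kappa> b = 0"
  have "{b\<in>Basis. \<kappa> b = 0} \<noteq> {}" using 0 b by blast
  then have "card {b\<in>Basis. \<kappa> b = 0} \<noteq> 0" by simp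
  then have "dim (principal_space W N u 0) \<noteq> 0"
    by (simp only: frame_dim_principal_space[OF F W N] not_False_eq_True)
  then have "0 ^ dim (principal_space W N u 0) = (0::real)"
    by (simp only: power_0_left if_False)
  then have "gauss_kronecker W N u = 0"
    unfolding gauss_kronecker_def frame_principal_curvatures[OF F W N]
    using 0 b by (intro prod_zero) force+
  then show False using H by simp
qed

section \<open>Continuity of the sum of the radii of curvature\<close>

text \<open>
  Applied to \<open>R \<circ> B\<close> and \<open>T\<close> with \<open>R\<close> the inverse of \<open>T\<close>, it gives the invariance of the trace under a
  change of basis.
\<close>

lemma trace_mult_commute:
  fixes A B :: "'m::euclidean_space \<Rightarrow> 'm"
  assumes "linear A" "linear B"
  shows "(\<Sum>b\<in>Basis. A (B b) \<bullet> b) = (\<Sum>b\<in>Basis. B (A b) \<bullet> b)"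
proof -
  have expand: "L (M b) \<bullet> b = (\<Sum>c\<in>Basis. (M b \<bullet> c) * (L c \<bullet> b))"
    if "linear L" for L M :: "'m \<Rightarrow> 'm" and b
  proof -
    have "L (M b) = L (\<Sum>c\<in>Basis. (M b \<bullet> c) *\<^sub>R c)" by (simp add: euclidean_representation)
    also have "\<dots> = (\<Sum>c\<in>Basis. (M b \<bullet> c) *\<^sub>R L c)" using that by (simp add: linear_sum linear_scale)
    finally show ?thesis by (simp add: inner_sum_left)
  qed
  have "(\<Sum>b\<in>Basis. A (B b) \<bullet> b) = (\<Sum>b\<in>Basis. \<Sum>c\<in>Basis. (B b \<bullet> c) * (A c \<bullet> b))"
    by (intro sum.cong refl expand assms(1))
  also have "\<dots> = (\<Sum>c\<in>Basis. \<Sum>b\<in>Basis. (A c \<bullet> b) * (B b \<bullet> c))"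
    by (subst sum.swap) (simp only: mult.commute)
  also have "\<dots> = (\<Sum>c\<in>Basis. B (A c) \<bullet> c)"
    by (intro sum.cong refl expand[symmetric] assms(2))
  finally show ?thesis .
qed

lemma gauss_derivative_inj:
  assumes "linear (frechet_derivative N (at u))" "0 \<notin> principal_curvatures W N u"
  shows "inj (frechet_derivative N (at u))"
proof -
  have "h = 0" if "frechet_derivative N (at u) h = 0" for h
    using assms(2) that unfolding principal_curvatures_def principal_space_def by auto
  then show ?thesis using assms(1) linear_injective_0 by blast
qed

text \<open>
  The map \<open>B = - dN\<^sup>-\<^sup>1 dW\<close> has the radii of curvature \<open>1/\<kappa>\<close> as its eigenvalues.  Unlike the eigenvalues
  or the frame, it depends continuously on the point.
\<close>

lemma radial_curvature_sum_eq_trace: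
  assumes F: "principal_frame W N u T \<kappa>"
    and W: "linear (frechet_derivative W (at u))" "inj (frechet_derivative W (at u))"
    and N: "linear (frechet_derivative N (at u))"
    and nz: "0 \<notin> principal_curvatures W N u"
    and B: "linear B" "\<And>h. frechet_derivative N (at u) (B h) = - frechet_derivative W (at u) h"
  shows "radial_curvature_sum W N u = (\<Sum>b\<in>Basis. B b \<bullet> b)"
proof -
  have T: "linear T" "inj T" using F by (auto simp: principal_frame_def)
  obtain R where R: "linear R" "R \<circ> T = id" using linear_injective_left_inverse[OF T] by blast
  have RT: "R (T h) = h" for h using fun_cong[OF R(2), of h] by simp
  have TR: "T (R h) = h" for h
  proof -
    obtain x where "h = T x" using surjD[OF linear_injective_imp_surjective[OF T]] by blast
    then show ?thesis by (simp only: RT)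
  qed
  have \<kappa>: "\<kappa> b \<noteq> 0" if "b \<in> Basis" for b
    using nz that unfolding frame_principal_curvatures[OF F W N] by force
  have "B (T b) = (1 / \<kappa> b) *\<^sub>R T b" if "b \<in> Basis" for b
  proof (rule injD[OF gauss_derivative_inj[OF N nz]])
    show "frechet_derivative N (at u) (B (T b)) = frechet_derivative N (at u) ((1 / \<kappa> b) *\<^sub>R T b)"
      using F that \<kappa>[OF that] by (simp add: B(2) linear_scale[OF N] principal_frame_def)
  qed
  then have "(\<Sum>b\<in>Basis. R (B (T b)) \<bullet> b) = (\<Sum>b\<in>Basis. 1 / \<kappa> b)"
    by (simp add: linear_scale[OF R(1)] RT)
  moreover have "(\<Sum>b\<in>Basis. (R \<circ> B) (T b) \<bullet> b) = (\<Sum>b\<in>Basis. T ((R \<circ> B) b) \<bullet> b)"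
    by (rule trace_mult_commute[OF linear_compose[OF B(1) R(1)] T(1)])
  ultimately show ?thesis
    by (simp only: frame_radial_curvature_sum[OF F W N] comp_apply TR)
qed

lemma gauss_derivative_range:
  assumes W: "immersed_hypersurface_on S W" and N: "gauss_map_on S W N" and u: "u \<in> S"
    and nz: "0 \<notin> principal_curvatures W N u" and x: "N u \<bullet> x = 0"
  shows "x \<in> range (frechet_derivative N (at u))"
proof -
  have S: "open S" using W by (simp add: immersed_hypersurface_on_def)
  note L = tangent_maps(3)[OF W N u]
  have "N u \<noteq> 0" using N u by (auto simp: gauss_map_on_def)
  then show ?thesis
    by (intro range_eq_orthogonal_complement[OF L gauss_derivative_inj[OF L nz] _ _ x]
        gauss_map_derivative_tangent[OF N S u])
qed

text \<open>
  Maps close to an injective linear map of a finite-dimensional space are bounded below by a common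
  constant, so convergence of the right-hand sides of \<open>L x (y x) = r x\<close> carries over to the solutions.
\<close>

lemma solution_of_linear_system_tendsto:
  fixes L :: "'x \<Rightarrow> 'm::euclidean_space \<Rightarrow> 'e::euclidean_space"
  assumes lin: "\<forall>\<^sub>F x in F. linear (L x)" and L0: "linear L0" "inj L0"
    and L: "\<And>h. ((\<lambda>x. L x h) \<longlongrightarrow> L0 h) F"
    and y: "((\<lambda>x. L x (y x)) \<longlongrightarrow> L0 y0) F"
  shows "(y \<longlongrightarrow> y0) F"
proof -
  obtain c where c: "c > 0" "\<And>h. c * norm h \<le> norm (L0 h)"
    using linear_inj_bounded_below_pos[OF L0] by metis
  define d where "d = (\<lambda>x. \<Sum>b\<in>Basis. norm (L x b - L0 b))"
  have d: "norm (L x h - L0 h) \<le> d x * norm h" if lin: "linear (L x)" for x h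
  proof -
    have "L x h - L0 h = (\<Sum>b\<in>Basis. (h \<bullet> b) *\<^sub>R (L x b - L0 b))"
    proof -
      have "M h = (\<Sum>b\<in>Basis. (h \<bullet> b) *\<^sub>R M b)" if "linear M" for M :: "'m \<Rightarrow> 'e"
        using that by (subst euclidean_representation[of h, symmetric]) (simp add: linear_sum linear_scale)
      from this[OF lin] this[OF L0(1)] show ?thesis
        by (metis (no_types, lifting) scaleR_diff_right sum.cong sum_subtractf)
    qed
    also have "norm \<dots> \<le> (\<Sum>b\<in>Basis. norm h * norm (L x b - L0 b))"
      by (intro sum_norm_le) (auto intro!: mult_right_mono simp: Basis_le_norm)
    finally show ?thesis by (simp add: d_def sum_distrib_left mult.commute)
  qed
  have "(d \<longlongrightarrow> (\<Sum>b\<in>Basis. norm (L0 b - L0 b))) F"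
    unfolding d_def by (intro tendsto_intros L)
  then have "(d \<longlongrightarrow> 0) F" by simp
  then have small: "\<forall>\<^sub>F x in F. d x < c / 2" using c by (intro order_tendstoD) auto
  have "((\<lambda>x. (2 / c) * norm (L x (y x) - L x y0)) \<longlongrightarrow> (2 / c) * norm (L0 y0 - L0 y0)) F"
    by (intro tendsto_intros y L)
  then have lim: "((\<lambda>x. (2 / c) * norm (L x (y x) - L x y0)) \<longlongrightarrow> 0) F" by simp
  have "\<forall>\<^sub>F x in F. norm (y x - y0) \<le> (2 / c) * norm (L x (y x) - L x y0)"
    using small lin
  proof eventually_elim
    case (elim x)
    let ?h = "y x - y0"
    have "c * norm ?h \<le> norm (L x ?h) + d x * norm ?h"
      using c(2)[of ?h] d[OF elim(2), of ?h] norm_triangle_sub[of "L0 ?h" "L x ?h"]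
      by (simp add: norm_minus_commute)
    also have "\<dots> \<le> norm (L x ?h) + (c / 2) * norm ?h"
      using elim(1) by (intro add_left_mono mult_right_mono) auto
    finally have "c * norm ?h \<le> norm (L x ?h) + (c / 2) * norm ?h" .
    then show ?case using c(1) by (simp add: field_simps linear_diff[OF elim(2)])
  qed
  then have "((\<lambda>x. y x - y0) \<longlongrightarrow> 0) F" by (rule Lim_null_comparison[OF _ lim])
  then show ?thesis using LIM_zero_cancel by blast
qed

text \<open>
  The sum is the trace of the map \<open>B u\<close> solving \<open>dN (B u h) = - dW h\<close>, a linear system whose
  coefficients are continuous.
\<close>

lemma radial_curvature_sum_continuous:
  assumes W: "immersed_hypersurface_on S W" and N: "gauss_map_on S W N" and D: "D \<subseteq> S"
    and nz: "\<And>u. u \<in> D \<Longrightarrow> 0 \<notin> principal_curvatures W N u"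
  shows "continuous_on D (radial_curvature_sum W N)"
proof -
  define P where "P = (\<lambda>u. frechet_derivative W (at u))"
  define Q where "Q = (\<lambda>u. frechet_derivative N (at u))"
  have lin: "linear (P u)" "linear (Q u)" "inj (Q u)" if "u \<in> D" for u
    using tangent_maps[OF W N, of u] gauss_derivative_inj[OF _ nz[OF that]] D that
    by (auto simp: P_def Q_def)
  have cont: "continuous_on D (\<lambda>u. P u h)" "continuous_on D (\<lambda>u. Q u h)" for h
  proof -
    have "(\<lambda>u. P u h) differentiable_on S"
      using W by (auto simp: immersed_hypersurface_on_def numeral_2_eq_2 P_def)
    then show "continuous_on D (\<lambda>u. P u h)"
      by (rule continuous_on_subset[OF differentiable_imp_continuous_on D])
    show "continuous_on D (\<lambda>u. Q u h)"
      using N unfolding gauss_map_on_def One_nat_def C_k_on.simps Q_def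
      by (intro continuous_on_subset[OF _ D]) blast
  qed
  have "\<exists>B. linear B \<and> (\<forall>h. Q u (B h) = - P u h)" if u: "u \<in> D" for u
  proof -
    have uS: "u \<in> S" using u D by blast
    obtain g where g: "linear g" "g \<circ> Q u = id"
      using linear_injective_left_inverse[OF lin(2,3)[OF u]] by blast
    have "Q u (g (- P u h)) = - P u h" for h
    proof -
      have "N u \<bullet> (- P u h) = 0" using N uS by (simp add: gauss_map_on_def P_def)
      then obtain x where x: "- P u h = Q u x"
        using gauss_derivative_range[OF W N uS nz[OF u]] unfolding Q_def by blast
      then show ?thesis using fun_cong[OF g(2), of x] by simp
    qed
    moreover have "linear (\<lambda>h. g (- P u h))"
      using linear_compose[OF linear_compose_neg[OF lin(1)[OF u]] g(1)] by (simp add: comp_def)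
    ultimately show ?thesis by blast
  qed
  then have "\<exists>B. \<forall>u\<in>D. linear (B u) \<and> (\<forall>h. Q u (B u h) = - P u h)" by (intro bchoice) blast
  then obtain B where B: "\<And>u. u \<in> D \<Longrightarrow> linear (B u)" "\<And>u h. u \<in> D \<Longrightarrow> Q u (B u h) = - P u h"
    by blast
  have trace: "radial_curvature_sum W N u = (\<Sum>b\<in>Basis. B u b \<bullet> b)" if u: "u \<in> D" for u
  proof -
    have uS: "u \<in> S" using u D by blast
    obtain T \<kappa> where F: "principal_frame W N u T \<kappa>" using principal_frame_exists[OF W N uS] by blast
    show ?thesis
      by (rule radial_curvature_sum_eq_trace[OF F tangent_maps[OF W N uS] nz[OF u] B(1)[OF u]])
        (rule B(2)[OF u, unfolded P_def Q_def])
  qed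
  have "continuous_on D (\<lambda>u. B u b)" for b
    unfolding continuous_on_def
  proof
    fix u0 assume u0: "u0 \<in> D"
    show "((\<lambda>u. B u b) \<longlongrightarrow> B u0 b) (at u0 within D)"
    proof (rule solution_of_linear_system_tendsto[of Q _ "Q u0"])
      have ev: "\<forall>\<^sub>F u in at u0 within D. u \<in> D" by (simp add: eventually_at_filter)
      then show "\<forall>\<^sub>F u in at u0 within D. linear (Q u)" by eventually_elim (rule lin)
      show "linear (Q u0)" "inj (Q u0)" using lin u0 by auto
      show "((\<lambda>u. Q u h) \<longlongrightarrow> Q u0 h) (at u0 within D)" for h
        using cont(2) u0 by (simp add: continuous_on_def)
      have "((\<lambda>u. - P u b) \<longlongrightarrow> - P u0 b) (at u0 within D)"
        using cont(1) u0 by (intro tendsto_minus) (simp add: continuous_on_def)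
      moreover have "\<forall>\<^sub>F u in at u0 within D. - P u b = Q u (B u b)"
        using ev by eventually_elim (simp add: B(2))
      ultimately show "((\<lambda>u. Q u (B u b)) \<longlongrightarrow> Q u0 (B u0 b)) (at u0 within D)"
        unfolding B(2)[OF u0] by (rule Lim_transform_eventually)
    qed
  qed
  then have "continuous_on D (\<lambda>u. \<Sum>b\<in>Basis. B u b \<bullet> b)" by (intro continuous_intros)
  then show ?thesis by (simp only: continuous_on_cong[OF refl trace])
qed

section \<open>Zeros of the angle function\<close>

lemma inner_e1: "x \<bullet> e1 = fst x"
  by (cases x) (simp add: e1_def)

text \<open>
  Where \<open>N \<bullet> e1 = 0\<close>, the vector \<open>e1\<close> is tangent, hence of the form \<open>dN h\<close>, and the derivative of
  \<open>N \<bullet> e1\<close> in the direction \<open>h\<close> is \<open>1\<close>.  So the angle function cannot vanish on a neighbourhood.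
\<close>

lemma angle_nonzero_dense:
  assumes W: "immersed_hypersurface_on S W" and N: "gauss_map_on S W N"
    and A: "open A" "A \<subseteq> S" "u \<in> A" and nz: "0 \<notin> principal_curvatures W N u"
  shows "\<exists>y\<in>A. N y \<bullet> e1 \<noteq> 0"
proof (rule ccontr)
  assume "\<not> ?thesis"
  then have zero: "\<And>y. y \<in> A \<Longrightarrow> N y \<bullet> e1 = 0" by blast
  have S: "open S" using W by (simp add: immersed_hypersurface_on_def)
  have u: "u \<in> S" using A by blast
  obtain h where h: "e1 = frechet_derivative N (at u) h"
    using gauss_derivative_range[OF W N u nz zero[OF A(3)]] by blast
  have "((\<lambda>y. N y \<bullet> e1) has_derivative (\<lambda>h. frechet_derivative N (at u) h \<bullet> e1)) (at u)"
    by (rule has_derivative_inner_left[OF gauss_map_has_derivative[OF N S u]])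
  moreover have "((\<lambda>y. N y \<bullet> e1) has_derivative (\<lambda>h. 0)) (at u)"
    by (rule has_derivative_transform_within_open[OF has_derivative_const A(1,3)]) (simp add: zero)
  ultimately have "frechet_derivative N (at u) h \<bullet> e1 = 0"
    by (rule has_derivative_unique[THEN fun_cong])
  then show False by (simp add: inner_e1 flip: h) (simp add: e1_def)
qed

text \<open>
  On a box inside \<open>\<Omega>\<close> fix some \<open>y\<close> with \<open>g y \<noteq> 0\<close>: there \<open>G v = F y / g y\<close> does not depend on \<open>v\<close>.  A
  product \<open>U \<times> V\<close> is such a box itself; otherwise local constancy and connectedness are used.
\<close>

lemma separated_factor_constant:
  fixes F g :: "'a::topological_space \<Rightarrow> real" and G :: "'b::topological_space \<Rightarrow> real"
  assumes \<Omega>: "open \<Omega>" "connected \<Omega> \<or> \<Omega> = U \<times> V"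
    and eq: "\<And>u v. (u, v) \<in> \<Omega> \<Longrightarrow> F u = g u * G v"
    and dense: "\<And>A u v. open A \<Longrightarrow> u \<in> A \<Longrightarrow> (u, v) \<in> \<Omega> \<Longrightarrow> A \<subseteq> fst ` \<Omega> \<Longrightarrow> \<exists>y\<in>A. g y \<noteq> 0"
  shows "\<exists>c. \<forall>p\<in>\<Omega>. G (snd p) = c"
proof (cases "\<Omega> = {}")
  case False
  then obtain u0 v0 where p0: "(u0, v0) \<in> \<Omega>" by fastforce
  have "G (snd p) = G (snd (u0, v0))" if p: "p \<in> \<Omega>" for p
    using \<Omega>(2)
  proof
    assume "\<Omega> = U \<times> V"
    obtain y where y: "y \<in> fst ` \<Omega>" "g y \<noteq> 0"
      using dense[OF open_image_fst[OF \<Omega>(1)] _ p0 subset_refl] p0 by force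
    then have "(y, v) \<in> \<Omega>" if "v \<in> V" for v using \<open>\<Omega> = U \<times> V\<close> that by force
    then show ?thesis using eq y(2) p p0 \<open>\<Omega> = U \<times> V\<close>
      by (metis mem_Sigma_iff mult_left_cancel prod.collapse)
  next
    assume "connected \<Omega>"
    then show ?thesis
    proof (rule connected_local_const[OF _ p p0, of "\<lambda>p. G (snd p)"], intro ballI)
      fix q assume q: "q \<in> \<Omega>"
      then obtain A B where AB: "open A" "open B" "q \<in> A \<times> B" "A \<times> B \<subseteq> \<Omega>"
        using \<Omega>(1) by (metis open_prod_def)
      have "A \<subseteq> fst ` \<Omega>" using AB(3,4) by force
      then obtain y where y: "y \<in> A" "g y \<noteq> 0"
        using dense[of A "fst q" "snd q"] AB q by auto
      have "G (snd q) = G (snd r)" if "r \<in> A \<times> B" for r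
      proof -
        have "(y, snd q) \<in> \<Omega>" "(y, snd r) \<in> \<Omega>" using AB(3,4) y(1) that by auto
        then have "g y * G (snd q) = g y * G (snd r)" using eq by metis
        then show ?thesis using y(2) by simp
      qed
      then show "\<forall>\<^sub>F r in at q within \<Omega>. G (snd q) = G (snd r)"
        unfolding eventually_at_topological using AB by (intro exI[of _ "A \<times> B"]) (auto intro: open_Times)
    qed
  qed
  then show ?thesis by blast
qed simp

section \<open>Parallel hypersurfaces\<close>

text \<open>
  A kernel vector of \<open>dY + \<tau> dN\<close> is a principal direction with curvature \<open>1/\<tau>\<close>.
\<close>

lemma parallel_derivative_inj:
  assumes P: "linear (frechet_derivative Y (at u))" "inj (frechet_derivative Y (at u))"
    and Q: "linear (frechet_derivative NY (at u))"
    and reg: "\<forall>\<kappa>\<in>principal_curvatures Y NY u. 1 - \<tau> * \<kappa> \<noteq> 0"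
    and h: "frechet_derivative Y (at u) h + \<tau> *\<^sub>R frechet_derivative NY (at u) h = 0"
  shows "h = 0"
proof (rule ccontr)
  assume "h \<noteq> 0"
  show False
  proof (cases "\<tau> = 0")
    case True
    then show False using h \<open>h \<noteq> 0\<close> linear_injective_0[OF P(1)] P(2) by auto
  next
    case False
    have "\<tau> *\<^sub>R frechet_derivative NY (at u) h = - frechet_derivative Y (at u) h"
      using h by (simp add: eq_neg_iff_add_eq_0 add.commute)
    then have "(1 / \<tau>) *\<^sub>R (\<tau> *\<^sub>R frechet_derivative NY (at u) h) = (1 / \<tau>) *\<^sub>R (- frechet_derivative Y (at u) h)"
      by (rule arg_cong)
    then have "frechet_derivative NY (at u) h = - (1 / \<tau>) *\<^sub>R frechet_derivative Y (at u) h"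
      using False by simp
    then have "1 / \<tau> \<in> principal_curvatures Y NY u"
      using \<open>h \<noteq> 0\<close> unfolding principal_curvatures_def principal_space_def by blast
    then show False using reg False by auto
  qed
qed

text \<open>
  A parallel hypersurface keeps the principal directions, and every radius of curvature decreases by
  \<open>\<tau>\<close>.
\<close>

lemma parallel_radial_curvature_sum:
  fixes Y :: "'m::euclidean_space \<Rightarrow> real \<times> 'm"
  assumes Y: "immersed_hypersurface_on S Y" and N: "gauss_map_on S Y NY" and u: "u \<in> S"
    and nz: "0 \<notin> principal_curvatures Y NY u"
    and reg: "\<forall>\<kappa>\<in>principal_curvatures Y NY u. 1 - \<tau> * \<kappa> \<noteq> 0"
  shows "radial_curvature_sum (parallel_hypersurface \<tau> Y NY) NY u
    = radial_curvature_sum Y NY u - real DIM('m) * \<tau>"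
proof -
  have S: "open S" using Y by (simp add: immersed_hypersurface_on_def)
  note L = tangent_maps[OF Y N u]
  define P where "P = frechet_derivative Y (at u)"
  define Q where "Q = frechet_derivative NY (at u)"
  obtain T \<kappa> where F: "principal_frame Y NY u T \<kappa>" using principal_frame_exists[OF Y N u] by blast
  have \<kappa>: "\<kappa> b \<noteq> 0" "1 - \<tau> * \<kappa> b \<noteq> 0" if "b \<in> Basis" for b
    using nz reg that unfolding frame_principal_curvatures[OF F L] by auto
  have "(parallel_hypersurface \<tau> Y NY has_derivative (\<lambda>h. P h + \<tau> *\<^sub>R Q h)) (at u)"
    unfolding parallel_hypersurface_def P_def Q_def
    by (intro has_derivative_add has_derivative_scaleR_right immersed_hypersurface_has_derivative[OF Y u]
        gauss_map_has_derivative[OF N S u])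
  then have D: "frechet_derivative (parallel_hypersurface \<tau> Y NY) (at u) = (\<lambda>h. P h + \<tau> *\<^sub>R Q h)"
    by (rule frechet_derivative_at[symmetric])
  have lin: "linear (\<lambda>h. P h + \<tau> *\<^sub>R Q h)"
    using L by (auto simp: P_def Q_def intro!: linear_compose_add linear_compose_scale_right)
  have inj: "inj (\<lambda>h. P h + \<tau> *\<^sub>R Q h)"
    using parallel_derivative_inj[OF L reg] linear_injective_0[OF lin] by (auto simp: P_def Q_def)
  have "principal_frame (parallel_hypersurface \<tau> Y NY) NY u T (\<lambda>b. \<kappa> b / (1 - \<tau> * \<kappa> b))"
    unfolding principal_frame_def D
  proof (intro conjI ballI)
    fix b :: 'm assume b: "b \<in> Basis"
    have "Q (T b) = - \<kappa> b *\<^sub>R P (T b)" using F b by (simp add: principal_frame_def P_def Q_def)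
    moreover from this have "P (T b) + \<tau> *\<^sub>R Q (T b) = (1 - \<tau> * \<kappa> b) *\<^sub>R P (T b)"
      by (simp add: scaleR_left_diff_distrib)
    ultimately show "frechet_derivative NY (at u) (T b)
        = - (\<kappa> b / (1 - \<tau> * \<kappa> b)) *\<^sub>R (P (T b) + \<tau> *\<^sub>R Q (T b))"
      using \<kappa>(2)[OF b] by (simp add: Q_def)
  qed (use F in \<open>auto simp: principal_frame_def\<close>)
  then have "radial_curvature_sum (parallel_hypersurface \<tau> Y NY) NY u
      = (\<Sum>b\<in>Basis. 1 / (\<kappa> b / (1 - \<tau> * \<kappa> b)))"
    by (rule frame_radial_curvature_sum) (simp_all only: D lin inj L(3))
  also have "\<dots> = (\<Sum>b\<in>Basis. 1 / \<kappa> b - \<tau>)"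
    using \<kappa> by (intro sum.cong) (auto simp: field_simps)
  also have "\<dots> = radial_curvature_sum Y NY u - real DIM('m) * \<tau>"
    by (simp add: sum_subtractf frame_radial_curvature_sum[OF F L])
  finally show ?thesis .
qed

lemma parallel_radial_equation_iff:
  fixes Y :: "'m::euclidean_space \<Rightarrow> real \<times> 'm"
  assumes Y: "immersed_hypersurface_on S Y" and N: "gauss_map_on S Y NY" and u: "u \<in> S"
    and nz: "0 \<notin> principal_curvatures Y NY u"
    and reg: "\<forall>\<kappa>\<in>principal_curvatures Y NY u. 1 - \<tau> * \<kappa> \<noteq> 0"
  shows "radial_equation a b (parallel_hypersurface \<tau> Y NY) NY u \<longleftrightarrow>
    (NY u \<bullet> e1) * radial_curvature_sum Y NY u - a * (Y u \<bullet> e1) - b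
      = (real DIM('m) + a) * \<tau> * (NY u \<bullet> e1)"
proof -
  have "parallel_hypersurface \<tau> Y NY u \<bullet> e1 = Y u \<bullet> e1 + \<tau> * (NY u \<bullet> e1)"
    by (simp add: parallel_hypersurface_def inner_add_left)
  then show ?thesis
    unfolding radial_equation_def parallel_radial_curvature_sum[OF assms]
    by (intro diff_eq_diff_eq) (simp add: algebra_simps)
qed

section \<open>Unit normals of an immersion\<close>

lemma unit_normal_unique_upto_sign:
  fixes L :: "'m::euclidean_space \<Rightarrow> real \<times> 'm"
  assumes L: "linear L" "inj L" and n: "norm n = 1" "\<And>h. n \<bullet> L h = 0"
    and m: "norm m = 1" "\<And>h. m \<bullet> L h = 0"
  shows "m = (m \<bullet> n) *\<^sub>R n" "(m \<bullet> n)\<^sup>2 = 1"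
proof -
  have nn: "n \<bullet> n = 1" "m \<bullet> m = 1" using n m by (simp_all flip: power2_norm_eq_inner)
  define r where "r = m - (m \<bullet> n) *\<^sub>R n"
  have "n \<bullet> r = 0" using nn by (simp add: r_def inner_diff_right inner_commute)
  then have "r \<in> range L" using n by (intro range_eq_orthogonal_complement[OF L, of n]) auto
  then obtain h where "r = L h" by blast
  then have "r \<bullet> r = 0" using n(2)[of h] m(2)[of h]
    by (subst (1) r_def) (simp add: inner_diff_left)
  then show eq: "m = (m \<bullet> n) *\<^sub>R n" by (simp add: r_def)
  have "m \<bullet> m = (m \<bullet> n) * (m \<bullet> n)" by (subst (2) eq) (simp)
  then show "(m \<bullet> n)\<^sup>2 = 1" using nn by (simp add: power2_eq_square)
qed

text \<open>
  Two continuous unit normals differ by a sign that is continuous, hence locally constant.  Agreement on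
  a whole neighbourhood is what allows their derivatives to be compared.
\<close>

lemma unit_normals_agree_near:
  fixes W' :: "'m::euclidean_space \<Rightarrow> 'm \<Rightarrow> real \<times> 'm"
  assumes S: "open S" "p \<in> S"
    and L: "\<And>q. q \<in> S \<Longrightarrow> linear (W' q)" "\<And>q. q \<in> S \<Longrightarrow> inj (W' q)"
    and n: "continuous_on S n" "\<And>q. q \<in> S \<Longrightarrow> norm (n q) = 1" "\<And>q h. q \<in> S \<Longrightarrow> n q \<bullet> W' q h = 0"
    and m: "continuous_on S m" "\<And>q. q \<in> S \<Longrightarrow> norm (m q) = 1" "\<And>q h. q \<in> S \<Longrightarrow> m q \<bullet> W' q h = 0"
  shows "\<exists>\<sigma> A. \<sigma> * \<sigma> = 1 \<and> open A \<and> p \<in> A \<and> A \<subseteq> S \<and> (\<forall>q\<in>A. m q = \<sigma> *\<^sub>R n q)"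
proof -
  define c where "c = (\<lambda>q. m q \<bullet> n q)"
  have c: "m q = c q *\<^sub>R n q" "c q = 1 \<or> c q = -1" if "q \<in> S" for q
    using unit_normal_unique_upto_sign[OF L[OF that] n(2,3)[OF that] m(2,3)[OF that]]
    by (simp_all add: c_def power2_eq_1_iff)
  have cont: "continuous_on S c" unfolding c_def by (intro continuous_intros n m)
  define A where "A = S \<inter> (\<lambda>q. c p * c q) -` {0<..}"
  have "open A" unfolding A_def
    by (intro continuous_open_preimage S(1) continuous_intros cont open_greaterThan)
  moreover have "p \<in> A" using c(2)[OF S(2)] S(2) by (auto simp: A_def)
  moreover have "m q = c p *\<^sub>R n q" if "q \<in> A" for q
  proof -
    have "c q = c p" using that c(2)[OF S(2)] c(2)[of q] by (auto simp: A_def)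
    then show ?thesis using c(1)[of q] that by (simp add: A_def)
  qed
  moreover have "c p * c p = 1" using c(2)[OF S(2)] by auto
  ultimately show ?thesis unfolding A_def by blast
qed

section \<open>The rotated translational hypersurface\<close>

text \<open>
  A vector of the directrix space \<open>span {e\<^sub>1, \<dots>, e\<^bsub>s+1\<^esub>}\<close> and one of
  \<open>span {e\<^bsub>s+2\<^esub>, \<dots>, e\<^bsub>s+t+1\<^esub>}\<close>, as one vector of the ambient space.
\<close>

definition join_coords :: "real \<times> 'a \<Rightarrow> 'b \<Rightarrow> real \<times> 'a \<times> 'b" where
  "join_coords y z = (fst y, snd y, z)"

lemma inner_join_coords [simp]: "join_coords y z \<bullet> join_coords y' z' = y \<bullet> y' + z \<bullet> z'"
  by (cases y; cases y') (simp add: join_coords_def)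

lemma scaleR_join_coords: "c *\<^sub>R join_coords y z = join_coords (c *\<^sub>R y) (c *\<^sub>R z)"
  by (simp add: join_coords_def)

lemma rotated_translational_eq:
  "rotated_translational Y NY Z (u, v) = join_coords (Y u + fst (Z v) *\<^sub>R NY u) (snd (Z v))"
proof -
  have "(\<Sum>r\<in>Basis. (Z v \<bullet> (0, r)) *\<^sub>R (0::real, 0::'a, r)) = (0, 0, \<Sum>r\<in>Basis. (snd (Z v) \<bullet> r) *\<^sub>R r)"
    by (simp add: prod_eq_iff fst_sum snd_sum inner_prod_def)
  then show ?thesis
    by (simp add: rotated_translational_def directrix_incl_def join_coords_def inner_e1 euclidean_representation)
qed

lemma rotated_translational_has_derivative:
  assumes Y: "(Y has_derivative Y') (at u)" and N: "(NY has_derivative N') (at u)"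
    and Z: "(Z has_derivative Z') (at v)"
  shows "(rotated_translational Y NY Z has_derivative
    (\<lambda>(h, k). join_coords (Y' h + fst (Z v) *\<^sub>R N' h + fst (Z' k) *\<^sub>R NY u) (snd (Z' k)))) (at (u, v))"
proof -
  have eq: "rotated_translational Y NY Z = (\<lambda>q. (fst (Y (fst q)) + fst (Z (snd q)) * fst (NY (fst q)),
      snd (Y (fst q)) + fst (Z (snd q)) *\<^sub>R snd (NY (fst q)), snd (Z (snd q))))"
    by (auto simp: fun_eq_iff rotated_translational_eq join_coords_def)
  have Y1: "((\<lambda>q. Y (fst q)) has_derivative (\<lambda>q. Y' (fst q))) (at (u, v))"
    by (rule has_derivative_compose[where g = Y, OF has_derivative_fst[OF has_derivative_ident]]) (simp add: Y)
  have N1: "((\<lambda>q. NY (fst q)) has_derivative (\<lambda>q. N' (fst q))) (at (u, v))"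
    by (rule has_derivative_compose[where g = NY, OF has_derivative_fst[OF has_derivative_ident]]) (simp add: N)
  have Z1: "((\<lambda>q. Z (snd q)) has_derivative (\<lambda>q. Z' (snd q))) (at (u, v))"
    by (rule has_derivative_compose[where g = Z, OF has_derivative_snd[OF has_derivative_ident]]) (simp add: Z)
  show ?thesis unfolding eq
    by (rule derivative_eq_intros Y1 N1 Z1 refl)+
      (auto simp: join_coords_def fun_eq_iff algebra_simps)
qed

text \<open>
  With \<open>Y\<close> replaced by \<open>0\<close> and \<open>Z\<close> by \<open>N\<^sup>Z\<close>, the formula for \<open>X\<close> produces a unit normal \<open>M\<close> of \<open>X\<close>, so
  one derivative rule serves both.  It agrees with \<open>NX\<close> up to a sign \<open>\<sigma>\<close>, locally constant, which
  flips both the angle and the curvatures and cancels in the product.  Frames of \<open>Y\<close> and \<open>Z\<close> combine to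
  a frame of \<open>X\<close>, from which the curvatures are read off; that none of them is zero forces
  \<open>N\<^sup>Z\<^sub>1 \<noteq> 0\<close> and nonzero curvatures of \<open>Y\<close>.
\<close>

lemma rotated_translational_angle_times_radial_sum:
  fixes Y NY :: "'a::euclidean_space \<Rightarrow> real \<times> 'a" and Z NZ :: "'b::euclidean_space \<Rightarrow> real \<times> 'b"
  assumes Y: "immersed_hypersurface_on U Y" and NY: "gauss_map_on U Y NY"
    and Z: "immersed_hypersurface_on V Z" and NZ: "gauss_map_on V Z NZ"
    and \<Omega>: "open \<Omega>" "\<Omega> \<subseteq> U \<times> V" and X: "X = rotated_translational Y NY Z"
    and reg: "\<forall>(u, v)\<in>\<Omega>. \<forall>\<kappa>\<in>principal_curvatures Y NY u. 1 - (Z v \<bullet> e1) * \<kappa> \<noteq> 0"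
    and NX: "gauss_map_on \<Omega> X NX" and p: "(u, v) \<in> \<Omega>"
    and H: "gauss_kronecker X NX (u, v) \<noteq> 0"
  shows "0 \<notin> principal_curvatures Y NY u"
    and "(NX (u, v) \<bullet> e1) * radial_curvature_sum X NX (u, v) =
      (NY u \<bullet> e1) * (radial_curvature_sum Y NY u - real DIM('a) * (Z v \<bullet> e1)
        + (NZ v \<bullet> e1) * radial_curvature_sum Z NZ v)"
proof -
  have opn: "open U" "open V" using Y Z by (auto simp: immersed_hypersurface_on_def)
  have uv: "u \<in> U" "v \<in> V" using p \<Omega> by auto
  define M where "M = rotated_translational (\<lambda>_. 0) NY NZ"
  define X' where "X' = (\<lambda>(u, v) (h, k). join_coords (frechet_derivative Y (at u) h
      + fst (Z v) *\<^sub>R frechet_derivative NY (at u) h + fst (frechet_derivative Z (at v) k) *\<^sub>R NY u)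
        (snd (frechet_derivative Z (at v) k)))"
  define M' where "M' = (\<lambda>(u, v) (h, k). join_coords (fst (NZ v) *\<^sub>R frechet_derivative NY (at u) h
      + fst (frechet_derivative NZ (at v) k) *\<^sub>R NY u) (snd (frechet_derivative NZ (at v) k)))"
  have X'_at: "(X has_derivative X' q) (at q)" if "q \<in> \<Omega>" for q
  proof -
    obtain x y where q: "q = (x, y)" "x \<in> U" "y \<in> V" using \<Omega> \<open>q \<in> \<Omega>\<close> by blast
    show ?thesis
      using rotated_translational_has_derivative[OF immersed_hypersurface_has_derivative[OF Y q(2)]
          gauss_map_has_derivative[OF NY opn(1) q(2)] immersed_hypersurface_has_derivative[OF Z q(3)]]
      by (simp add: q(1) X X'_def)
  qed
  have M'_at: "(M has_derivative M' q) (at q)" if "q \<in> \<Omega>" for q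
  proof -
    obtain x y where q: "q = (x, y)" "x \<in> U" "y \<in> V" using \<Omega> \<open>q \<in> \<Omega>\<close> by blast
    show ?thesis
      using rotated_translational_has_derivative[OF has_derivative_const[of 0]
          gauss_map_has_derivative[OF NY opn(1) q(2)] gauss_map_has_derivative[OF NZ opn(2) q(3)]]
      by (simp add: q(1) M_def M'_def)
  qed
  have X'_eq: "frechet_derivative X (at q) = X' q" if "q \<in> \<Omega>" for q
    using frechet_derivative_at[OF X'_at[OF that]] by simp
  have X'_lin: "linear (X' q)" if "q \<in> \<Omega>" for q
    using X'_at[OF that] by (rule has_derivative_linear)
  have X'_inj: "inj (X' q)" if q: "q \<in> \<Omega>" for q
  proof -
    obtain x y where xy: "q = (x, y)" "x \<in> U" "y \<in> V" using \<Omega> q by blast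
    have reg_q: "\<forall>\<kappa>\<in>principal_curvatures Y NY x. 1 - fst (Z y) * \<kappa> \<noteq> 0"
      using reg q by (auto simp: xy(1) inner_e1)
    note LY = tangent_maps[OF Y NY xy(2)] and LZ = tangent_maps[OF Z NZ xy(3)]
    have "w = 0" if w: "X' q w = 0" for w
    proof -
      obtain h k where hk: "w = (h, k)" by fastforce
      let ?t = "frechet_derivative Y (at x) h + fst (Z y) *\<^sub>R frechet_derivative NY (at x) h"
      have 0: "?t + fst (frechet_derivative Z (at y) k) *\<^sub>R NY x = 0" "snd (frechet_derivative Z (at y) k) = 0"
        using w by (auto simp: X'_def hk xy(1) join_coords_def zero_prod_def prod_eq_iff)
      have "NY x \<bullet> ?t = 0" "NY x \<bullet> NY x = 1"
        using NY xy(2) gauss_map_derivative_tangent[OF NY opn(1) xy(2)]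
        by (auto simp: gauss_map_on_def inner_add_right simp flip: power2_norm_eq_inner)
      then have "fst (frechet_derivative Z (at y) k) = NY x \<bullet> (?t + fst (frechet_derivative Z (at y) k) *\<^sub>R NY x)"
        by (simp only: inner_add_right[of _ ?t] inner_scaleR_right)
      then have fst0: "fst (frechet_derivative Z (at y) k) = 0" by (simp add: 0(1))
      then have "frechet_derivative Z (at y) k = 0" using 0(2) by (simp add: prod_eq_iff)
      then have "k = 0" using LZ(1,2) linear_injective_0 by blast
      moreover have "h = 0"
        by (rule parallel_derivative_inj[OF LY reg_q]) (use 0(1) fst0 in simp)
      ultimately show ?thesis by (simp add: hk zero_prod_def)
    qed
    then show ?thesis using linear_injective_0[OF X'_lin[OF q]] by blast
  qed
  have M_eq: "M (x, y) = join_coords (fst (NZ y) *\<^sub>R NY x) (snd (NZ y))" for x y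
    by (simp add: M_def rotated_translational_eq)
  have M_normal: "norm (M q) = 1" "M q \<bullet> X' q w = 0" if q: "q \<in> \<Omega>" for q w
  proof -
    obtain x y where xy: "q = (x, y)" "x \<in> U" "y \<in> V" using \<Omega> q by blast
    obtain h k where hk: "w = (h, k)" by fastforce
    have n: "NY x \<bullet> NY x = 1" "NZ y \<bullet> NZ y = 1" "NY x \<bullet> frechet_derivative Y (at x) h = 0"
      "NZ y \<bullet> frechet_derivative Z (at y) k = 0"
      using NY NZ xy by (auto simp: gauss_map_on_def simp flip: power2_norm_eq_inner)
    have "M q \<bullet> M q = NZ y \<bullet> NZ y"
      by (simp add: M_eq xy(1) n(1)) (simp add: inner_prod_def)
    then show "norm (M q) = 1" by (simp add: n(2) norm_eq_sqrt_inner)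
    have "M q \<bullet> X' q w = NZ y \<bullet> frechet_derivative Z (at y) k"
      using n(1,3) gauss_map_derivative_tangent[OF NY opn(1) xy(2), of h]
      by (simp add: M_eq X'_def xy(1) hk inner_add_right) (simp add: inner_prod_def)
    then show "M q \<bullet> X' q w = 0" by (simp add: n(4))
  qed
  have NX_at: "(NX has_derivative frechet_derivative NX (at q)) (at q)" if "q \<in> \<Omega>" for q
    by (rule gauss_map_has_derivative[OF NX \<Omega>(1) that])
  have cont: "continuous_on \<Omega> M" "continuous_on \<Omega> NX"
    using has_derivative_continuous[OF M'_at] has_derivative_continuous[OF NX_at]
    by (blast intro: continuous_at_imp_continuous_on)+
  have NX_normal: "norm (NX q) = 1" "NX q \<bullet> X' q w = 0" if "q \<in> \<Omega>" for q w
    using NX that unfolding gauss_map_on_def X'_eq[OF that, symmetric] by blast+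
  obtain \<sigma> A where \<sigma>: "\<sigma> * \<sigma> = 1" and A: "open A" "(u, v) \<in> A" "A \<subseteq> \<Omega>" "\<And>q. q \<in> A \<Longrightarrow> NX q = \<sigma> *\<^sub>R M q"
    using unit_normals_agree_near[of \<Omega> "(u, v)" X' M NX, OF \<Omega>(1) p X'_lin X'_inj cont(1) M_normal cont(2) NX_normal]
    by blast
  have "(NX has_derivative (\<lambda>w. \<sigma> *\<^sub>R M' (u, v) w)) (at (u, v))"
    by (rule has_derivative_transform_within_open[OF has_derivative_scaleR_right[OF M'_at[OF p]] A(1,2)])
      (simp add: A(4))
  then have NX'_eq: "frechet_derivative NX (at (u, v)) = (\<lambda>w. \<sigma> *\<^sub>R M' (u, v) w)"
    by (rule frechet_derivative_at[symmetric])
  have X_maps: "linear (frechet_derivative X (at (u, v)))" "inj (frechet_derivative X (at (u, v)))"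
    "linear (frechet_derivative NX (at (u, v)))"
    using X'_lin[OF p] X'_inj[OF p] NX_at[OF p] has_derivative_linear by (auto simp: X'_eq[OF p])
  note LY = tangent_maps[OF Y NY uv(1)] and LZ = tangent_maps[OF Z NZ uv(2)]
  obtain T \<kappa> where TF: "principal_frame Y NY u T \<kappa>" using principal_frame_exists[OF Y NY uv(1)] by blast
  obtain R \<mu> where RF: "principal_frame Z NZ v R \<mu>" using principal_frame_exists[OF Z NZ uv(2)] by blast
  have T: "linear T" "inj T" and R: "linear R" "inj R" using TF RF by (auto simp: principal_frame_def)
  have den: "1 - fst (Z v) * \<kappa> b \<noteq> 0" if "b \<in> Basis" for b
  proof -
    have "\<kappa> b \<in> principal_curvatures Y NY u"
      using that by (simp add: frame_principal_curvatures[OF TF LY])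
    then show ?thesis using reg p by (auto simp: inner_e1)
  qed
  define n1 where "n1 = fst (NZ v)"
  (* a basis vector of the product has second component 0 exactly when it belongs to the directrix *)
  define \<rho> where "\<rho> = (\<lambda>x. \<sigma> * (if snd x = 0 then n1 * \<kappa> (fst x) / (1 - fst (Z v) * \<kappa> (fst x)) else \<mu> (snd x)))"
  have XF: "principal_frame X NX (u, v) (\<lambda>x. (T (fst x), R (snd x))) \<rho>"
    unfolding principal_frame_def
  proof (intro conjI ballI)
    show "linear (\<lambda>x. (T (fst x), R (snd x)))"
      using T R by (auto intro!: linearI simp: linear_add linear_scale)
    show "inj (\<lambda>x. (T (fst x), R (snd x)))"
      using T R by (auto intro!: injI simp: inj_eq prod_eq_iff)
    fix x :: "'a \<times> 'b" assume "x \<in> Basis"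
    then consider b where "x = (b, 0)" "b \<in> Basis" | c where "x = (0, c)" "c \<in> Basis"
      by (auto simp: Basis_prod_def)
    then show "frechet_derivative NX (at (u, v)) (T (fst x), R (snd x)) =
        - \<rho> x *\<^sub>R frechet_derivative X (at (u, v)) (T (fst x), R (snd x))"
    proof cases
      case 1
      have eq: "frechet_derivative NY (at u) (T b) = - \<kappa> b *\<^sub>R frechet_derivative Y (at u) (T b)"
        using TF 1(2) by (simp add: principal_frame_def)
      let ?y = "frechet_derivative Y (at u) (T b)"
      have "X' (u, v) (T b, R 0) = (1 - fst (Z v) * \<kappa> b) *\<^sub>R join_coords ?y 0"
        using linear_0[OF LZ(1)] linear_0[OF R(1)]
        by (simp add: X'_def eq scaleR_join_coords scaleR_left_diff_distrib)
      moreover have "M' (u, v) (T b, R 0) = (- n1 * \<kappa> b) *\<^sub>R join_coords ?y 0"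
        using linear_0[OF LZ(3)] linear_0[OF R(1)]
        by (simp add: M'_def eq scaleR_join_coords n1_def)
      ultimately show ?thesis
        using den[OF 1(2)] by (simp add: 1(1) X'_eq[OF p] NX'_eq \<rho>_def)
    next
      case 2
      have "c \<noteq> 0" using 2(2) by auto
      moreover have "frechet_derivative NZ (at v) (R c) = - \<mu> c *\<^sub>R frechet_derivative Z (at v) (R c)"
        using RF 2(2) by (simp add: principal_frame_def)
      ultimately show ?thesis
        using LY T
        by (simp add: 2(1) X'_eq[OF p] NX'_eq X'_def M'_def join_coords_def \<rho>_def linear_0)
    qed
  qed
  have \<rho>_nz: "\<rho> x \<noteq> 0" if "x \<in> Basis" for x
    by (rule frame_gauss_kronecker_nonzero[OF XF X_maps H that])
  have \<rho>1: "\<rho> (b, 0) = \<sigma> * (n1 * \<kappa> b / (1 - fst (Z v) * \<kappa> b))" for b by (simp add: \<rho>_def)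
  have \<rho>2: "\<rho> (0, c) = \<sigma> * \<mu> c" if "c \<in> Basis" for c using that by (auto simp: \<rho>_def)
  have nz: "n1 \<noteq> 0" "\<kappa> b \<noteq> 0" if "b \<in> Basis" for b
    using \<rho>_nz[of "(b, 0)"] that unfolding \<rho>1 by (auto simp: Basis_prod_def)
  then show "0 \<notin> principal_curvatures Y NY u" unfolding frame_principal_curvatures[OF TF LY] by force
  have n1: "n1 \<noteq> 0" using nz(1) nonempty_Basis by blast
  have inv_\<sigma>: "1 / (\<sigma> * x) = \<sigma> * (1 / x)" for x
  proof -
    have "1 / \<sigma> = \<sigma>" using \<sigma> by (metis inverse_unique inverse_eq_divide)
    then show ?thesis by (metis divide_divide_eq_left times_divide_eq_right mult.right_neutral)
  qed
  have "radial_curvature_sum X NX (u, v) = (\<Sum>b\<in>Basis. 1 / \<rho> (b, 0)) + (\<Sum>c\<in>Basis. 1 / \<rho> (0, c))"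
    unfolding frame_radial_curvature_sum[OF XF X_maps] Basis_prod_def
    by (subst sum.union_disjoint) (auto simp: sum.reindex inj_on_def)
  also have "(\<Sum>b\<in>Basis. 1 / \<rho> (b, 0)) = (\<Sum>b\<in>Basis. (\<sigma> / n1) * (1 / \<kappa> b - fst (Z v)))"
    unfolding \<rho>1 inv_\<sigma> using nz n1 den by (intro sum.cong) (auto simp: field_simps)
  also have "\<dots> = (\<sigma> / n1) * (radial_curvature_sum Y NY u - real DIM('a) * fst (Z v))"
    unfolding sum_distrib_left[symmetric] by (simp add: sum_subtractf frame_radial_curvature_sum[OF TF LY])
  also have "(\<Sum>c\<in>Basis. 1 / \<rho> (0, c)) = \<sigma> * radial_curvature_sum Z NZ v"
    unfolding frame_radial_curvature_sum[OF RF LZ] sum_distrib_left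
    by (intro sum.cong refl) (simp only: \<rho>2 inv_\<sigma>)
  finally have sum_X: "radial_curvature_sum X NX (u, v) =
    (\<sigma> / n1) * (radial_curvature_sum Y NY u - real DIM('a) * fst (Z v)) + \<sigma> * radial_curvature_sum Z NZ v" .
  have "NX (u, v) \<bullet> e1 = \<sigma> * (n1 * fst (NY u))"
    by (simp add: A(4)[OF A(2)] M_eq inner_e1 join_coords_def n1_def)
  then have "(NX (u, v) \<bullet> e1) * radial_curvature_sum X NX (u, v) = (\<sigma> * \<sigma>) * (fst (NY u) *
      (radial_curvature_sum Y NY u - real DIM('a) * fst (Z v) + n1 * radial_curvature_sum Z NZ v))"
    unfolding sum_X using n1 by (simp add: field_simps)
  then show "(NX (u, v) \<bullet> e1) * radial_curvature_sum X NX (u, v) =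
      (NY u \<bullet> e1) * (radial_curvature_sum Y NY u - real DIM('a) * (Z v \<bullet> e1)
        + (NZ v \<bullet> e1) * radial_curvature_sum Z NZ v)"
    by (simp add: \<sigma> n1_def inner_e1)
qed

section \<open>The characterization\<close>

(* The domain Omega of X is any open part of U x V; it is connected, or all of U x V.
   The directrix and the profile of X are then Y over fst ` Omega and Z over snd ` Omega.
   If the parallel domain is dense in fst ` Omega, the two implications are the literal
   equivalence.  Without density the converse can fail: if Y is a sphere of radius tau, the
   parallel domain is empty and the condition on the directrix is void. *)

theorem theorem2p2:
  fixes a b :: real
    and U :: "'a::euclidean_space set" and V :: "'b::euclidean_space set"
    and \<Omega> :: "('a \<times> 'b) set"
    and Y NY :: "'a \<Rightarrow> real \<times> 'a"
    and Z NZ :: "'b \<Rightarrow> real \<times> 'b"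
    and X NX :: "'a \<times> 'b \<Rightarrow> real \<times> 'a \<times> 'b"
  assumes "immersed_hypersurface_on U Y" and "gauss_map_on U Y NY"
    and "immersed_hypersurface_on V Z" and "gauss_map_on V Z NZ"
    and "open \<Omega>" and "\<Omega> \<subseteq> U \<times> V" and "connected \<Omega> \<or> \<Omega> = U \<times> V"
    and "X = rotated_translational Y NY Z"
    and "\<forall>(u, v)\<in>\<Omega>. \<forall>\<kappa>\<in>principal_curvatures Y NY u. 1 - (Z v \<bullet> e1) * \<kappa> \<noteq> 0"
    and "gauss_map_on \<Omega> X NX"
    and "\<forall>p\<in>\<Omega>. gauss_kronecker X NX p \<noteq> 0"
    and "a \<noteq> - real DIM('a)"
  shows "((\<forall>p\<in>\<Omega>. radial_equation a b X NX p) \<longrightarrow>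
            (\<exists>C. directrix_profile_equations a b C Y NY (fst ` \<Omega>) Z NZ (snd ` \<Omega>))) \<and>
         (\<forall>C. directrix_profile_equations a b C Y NY (fst ` \<Omega>) Z NZ (snd ` \<Omega>) \<longrightarrow>
            (\<forall>p\<in>\<Omega>. fst p \<in> closure (parallel_domain (- C / (real DIM('a) + a)) Y NY (fst ` \<Omega>))
               \<longrightarrow> radial_equation a b X NX p))"
proof -
  note Y = assms(1) and NY = assms(2) and \<Omega> = assms(5,6)
  define s where "s = real DIM('a)"
  have sa: "s + a \<noteq> 0" using assms(12) by (simp add: s_def)
  define D where "D = fst ` \<Omega>"
  have D: "D \<subseteq> U" "open D"
    using \<Omega> by (auto simp: D_def intro: open_image_fst)
  define F where "F = (\<lambda>u. (NY u \<bullet> e1) * radial_curvature_sum Y NY u - a * (Y u \<bullet> e1) - b)"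
  define G where "G = (\<lambda>v. (a + s) * (Z v \<bullet> e1) - (NZ v \<bullet> e1) * radial_curvature_sum Z NZ v)"
  note angle = rotated_translational_angle_times_radial_sum[OF assms(1-6,8-10)]
  have nz: "0 \<notin> principal_curvatures Y NY u" if "u \<in> D" for u
    using that angle(1) assms(11) by (auto simp: D_def)
  have X_iff: "radial_equation a b X NX (u, v) \<longleftrightarrow> F u = (NY u \<bullet> e1) * G v" if uv: "(u, v) \<in> \<Omega>" for u v
  proof -
    have "X (u, v) \<bullet> e1 = Y u \<bullet> e1 + (Z v \<bullet> e1) * (NY u \<bullet> e1)"
      by (simp add: assms(8) rotated_translational_eq inner_e1 join_coords_def)
    moreover have "(NX (u, v) \<bullet> e1) * radial_curvature_sum X NX (u, v) =
      (NY u \<bullet> e1) * (radial_curvature_sum Y NY u - s * (Z v \<bullet> e1)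
        + (NZ v \<bullet> e1) * radial_curvature_sum Z NZ v)"
      using angle(2)[OF uv] assms(11) uv by (simp add: s_def)
    ultimately show ?thesis
      unfolding radial_equation_def F_def G_def by (intro diff_eq_diff_eq) (simp add: algebra_simps)
  qed
  have Z_iff: "radial_equation (a + s) C Z NZ v \<longleftrightarrow> G v = - C" for C v
    unfolding radial_equation_def G_def by (simp add: algebra_simps) argo
  have Y_iff: "radial_equation a b (parallel_hypersurface (- C / (s + a)) Y NY) NY u \<longleftrightarrow>
      F u = - C * (NY u \<bullet> e1)" if "u \<in> parallel_domain (- C / (s + a)) Y NY D" for C u
  proof -
    have u: "u \<in> D" "\<forall>\<kappa>\<in>principal_curvatures Y NY u. 1 - (- C / (s + a)) * \<kappa> \<noteq> 0"
      using that by (auto simp: parallel_domain_def)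
    have "(s + a) * (- C / (s + a)) = - C" using sa by simp
    then show ?thesis
      using parallel_radial_equation_iff[OF Y NY _ nz[OF u(1)] u(2), of a b] u(1) D(1)
      by (auto simp: F_def s_def)
  qed
  have equations_iff: "directrix_profile_equations a b C Y NY (fst ` \<Omega>) Z NZ (snd ` \<Omega>) \<longleftrightarrow>
      (\<forall>u\<in>parallel_domain (- C / (s + a)) Y NY D. F u = - C * (NY u \<bullet> e1)) \<and> (\<forall>p\<in>\<Omega>. G (snd p) = - C)" for C
    unfolding directrix_profile_equations_def Let_def s_def[symmetric] D_def[symmetric]
    using Y_iff Z_iff by (simp cong: ball_cong)
  show ?thesis
    unfolding equations_iff unfolding s_def[symmetric] D_def[symmetric]
  proof (intro conjI impI allI ballI)
    assume "\<forall>p\<in>\<Omega>. radial_equation a b X NX p"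
    then have sep: "F u = (NY u \<bullet> e1) * G v" if "(u, v) \<in> \<Omega>" for u v
      using X_iff[OF that] that by blast
    have "\<exists>y\<in>A. NY y \<bullet> e1 \<noteq> 0" if "open A" "u \<in> A" "A \<subseteq> D" for A u
      using angle_nonzero_dense[OF Y NY that(1) _ that(2) nz] that D(1) by blast
    then obtain c where c: "\<And>p. p \<in> \<Omega> \<Longrightarrow> G (snd p) = c"
      using separated_factor_constant[OF \<Omega>(1) assms(7), of F "\<lambda>u. NY u \<bullet> e1" G, OF sep]
      unfolding D_def by blast
    have "F u = c * (NY u \<bullet> e1)" if u: "u \<in> D" for u
    proof -
      obtain v where "(u, v) \<in> \<Omega>" using u unfolding D_def by fastforce
      then show ?thesis using sep[of u v] c[of "(u, v)"] by simp
    qed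
    then show "\<exists>C. (\<forall>u\<in>parallel_domain (- C / (s + a)) Y NY D. F u = - C * (NY u \<bullet> e1)) \<and> (\<forall>p\<in>\<Omega>. G (snd p) = - C)"
      using c by (intro exI[of _ "- c"]) (auto simp: parallel_domain_def)
  next
    fix C p
    assume C: "(\<forall>u\<in>parallel_domain (- C / (s + a)) Y NY D. F u = - C * (NY u \<bullet> e1)) \<and> (\<forall>p\<in>\<Omega>. G (snd p) = - C)"
      and p: "p \<in> \<Omega>" "fst p \<in> closure (parallel_domain (- C / (s + a)) Y NY D)"
    obtain u v where uv: "p = (u, v)" by fastforce
    have u: "u \<in> D" using p(1) by (force simp: uv D_def)
    have "continuous_on D Y" "continuous_on D NY"
      using immersed_hypersurface_has_derivative[OF Y] gauss_map_has_derivative[OF NY] Y D(1)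
      by (auto simp: immersed_hypersurface_on_def intro!: continuous_at_imp_continuous_on has_derivative_continuous)
    then have cont: "continuous_on D (\<lambda>u. F u + C * (NY u \<bullet> e1))"
      unfolding F_def by (intro continuous_intros radial_curvature_sum_continuous[OF Y NY D(1) nz])
    then have "closedin (top_of_set D) {x \<in> D. F x + C * (NY x \<bullet> e1) = 0}"
      by (rule continuous_closedin_preimage_constant)
    then obtain K where K: "closed K" "{x \<in> D. F x + C * (NY x \<bullet> e1) = 0} = D \<inter> K"
      by (auto simp: closedin_closed)
    have "parallel_domain (- C / (s + a)) Y NY D \<subseteq> D \<inter> K"
      using C unfolding K(2)[symmetric] by (auto simp: parallel_domain_def)
    then have "u \<in> K" using closure_minimal[of _ K] K(1) p(2) by (auto simp: uv)
    then have "F u + C * (NY u \<bullet> e1) = 0" using u K(2) by blast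
    moreover have "G v = - C" using C p(1) by (force simp: uv)
    ultimately have "F u = (NY u \<bullet> e1) * G v" by (simp add: algebra_simps add_eq_0_iff)
    then show "radial_equation a b X NX p" using X_iff[of u v] p(1) by (simp add: uv)
  qed
qed

end
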